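(* Let $G$ be an $\ell$-group. Then the following are equivalent. (1) $\mathbf{C}(G)$ is ideally conjunctive. (2) $G\in(\mathrm{Y})$, that is, $\mathfrak{C}(G)$ is a Yosida frame. (3) There is an index set $X$ and an embedding $\varphi\colon G\to\mathbb{R}^X$ such that $G(a)=I(\mathscr{Z}_\varphi(a))$ for every $a\in G$. (4) There is $\mathcal{M}\subseteq\mathrm{Max}(G)$ such that $\bigcap\mathcal{M}=\{0\}$ and $G(a)=I(\mathscr{Z}_{\mathcal{M}}(a))$ for every $a\in G$. (5) There is $\mathcal{M}\subseteq\mathrm{Max}(G)$ such that $\bigcap\mathcal{M}=\{0\}$ and $\mathcal{M}$ is patch dense in $\mathrm{Spec}(G)$ (dense with respect to the patch topology). (6) $H\in(\mathrm{Y})$ for every $\ell$-subgroup $H$ of $G$. (7) $G/G(a)$ has enough maximal convex $\ell$-subgroups for each $a\in G$.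
   Context: An $\ell$-group is a lattice-ordered group, and embeddings are embeddings of $\ell$-groups. For an $\ell$-group $G$, $\mathfrak{C}(G)$ is the lattice of convex $\ell$-subgroups ordered by inclusion, an algebraic frame in which the meet of two compact elements is compact. For $a\in G$, $G(a)=\{b\in G:|b|\le n|a|\text{ for some }n\in\mathbb{N}\}$ is the principal convex $\ell$-subgroup generated by $a$; $\mathbf{C}(G)=\{G(a):a\in G\}$ is the sublattice of compact elements of $\mathfrak{C}(G)$. $\mathrm{Max}(G)$ is the set of maximal (proper) convex $\ell$-subgroups, and $\mathrm{Spec}(G)$ is the set of proper prime subgroups (proper convex $\ell$-subgroups $p$ such that $a\wedge b=0$ implies $a\in p$ or $b\in p$). $\mathfrak{C}(G)$ is a Yosida frame (written $G\in(\mathrm{Y})$) if every compact element $G(a)$ is a meet of maximal elements, i.e. an intersection of members of $\mathrm{Max}(G)$ (the empty intersection being $G$). A join-semilattice $L$ is ideally conjunctive if for all $a,b\in L$ with $b\nleq a$ there is an ideal $W$ of $L$ with $a\in W\neq L=W\vee\mathrm{id}(b)$, where $\mathrm{id}(b)=\{x\in L:x\le b\}$ and the join is taken in the lattice of ideals of $L$. For an embedding $\varphi\colon G\to\mathbb{R}^X$ (with $\mathbb{R}^X$ ordered pointwise), $\mathscr{Z}_\varphi(a)=\{x\in X:\varphi(a)(x)=0\}$ and $I(\mathscr{Z}_\varphi(a))=\{b\in G:\mathscr{Z}_\varphi(b)\supseteq\mathscr{Z}_\varphi(a)\}$. For $\mathcal{M}\subseteq\mathrm{Max}(G)$, $\mathscr{Z}_{\mathcal{M}}(a)=\{m\in\mathcal{M}:a\in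 m\}$ and $I(\mathscr{Z}_{\mathcal{M}}(a))=\{b\in G:\mathscr{Z}_{\mathcal{M}}(b)\supseteq\mathscr{Z}_{\mathcal{M}}(a)\}$. The patch topology on $\mathrm{Spec}(G)$ has base the sets $\{p\in\mathrm{Spec}(G):a\notin p,\ b\in p\}$, $a,b\in G$. An $\ell$-group $K$ has enough maximal convex $\ell$-subgroups if $\bigcap\mathrm{Max}(K)=\{0\}$.
   Formalization: Every G(a) is assumed normal in G (automatic for abelian G), since otherwise G/G(a) in (7) is not an ℓ-group and (2) does not imply (3); the index set X in (3) is taken among sets of subsets of G, which suffices by keeping one index per kernel. *)

theory Defs
  imports "HOL-Analysis.Analysis" "HOL-Algebra.Coset" "HOL-Algebra.Lattice"
begin

text \<open>
  Lattice-ordered groups are written multiplicatively, following HOL-Algebra: the group operation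
  \<open>a + b\<close>, the neutral element \<open>0\<close>, the inverse \<open>-a\<close> and the multiple \<open>n |a|\<close> of the additive
  notation are \<open>a \<otimes> b\<close>, \<open>\<one>\<close>, \<open>inv a\<close> and \<open>|a| [^] n\<close>. The group is not required to be abelian.
\<close>

record 'a lgroup = "'a monoid" +
  lle :: "'a \<Rightarrow> 'a \<Rightarrow> bool"

text \<open>The underlying ordered set, to which the order-theoretic notions of HOL-Algebra apply.\<close>

definition lorder :: "('a, 'b) lgroup_scheme \<Rightarrow> 'a gorder" where
  "lorder G = \<lparr>carrier = carrier G, eq = (=), le = lle G\<rparr>"

locale lgroup = group G for G (structure) +
  assumes lattice_lorder: "lattice (lorder G)"
    and lle_translate: "\<lbrakk>x \<in> carrier G; y \<in> carrier G; u \<in> carrier G; v \<in> carrier G; lle G x y\<rbrakk>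
      \<Longrightarrow> lle G (u \<otimes> x \<otimes> v) (u \<otimes> y \<otimes> v)"

definition l_abs :: "('a, 'b) lgroup_scheme \<Rightarrow> 'a \<Rightarrow> 'a" where
  "l_abs G a = a \<squnion>\<^bsub>lorder G\<^esub> inv\<^bsub>G\<^esub> a"

definition l_subgroup :: "('a, 'b) lgroup_scheme \<Rightarrow> 'a set \<Rightarrow> bool" where
  "l_subgroup G H \<longleftrightarrow> subgroup H G \<and>
     (\<forall>x\<in>H. \<forall>y\<in>H. x \<squnion>\<^bsub>lorder G\<^esub> y \<in> H \<and> x \<sqinter>\<^bsub>lorder G\<^esub> y \<in> H)"

definition convex_l_subgroup :: "('a, 'b) lgroup_scheme \<Rightarrow> 'a set \<Rightarrow> bool" where
  "convex_l_subgroup G H \<longleftrightarrow> l_subgroup G H \<and>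
     (\<forall>x\<in>H. \<forall>y\<in>H. \<forall>z\<in>carrier G. lle G x z \<longrightarrow> lle G z y \<longrightarrow> z \<in> H)"

definition principal_l :: "('a, 'b) lgroup_scheme \<Rightarrow> 'a \<Rightarrow> 'a set" where
  "principal_l G a = {b \<in> carrier G. \<exists>n::nat. lle G (l_abs G b) (l_abs G a [^]\<^bsub>G\<^esub> n)}"

text \<open>The join-semilattice of principal (that is, compact) convex \<open>\<ell>\<close>-subgroups.\<close>

definition principal_lattice :: "('a, 'b) lgroup_scheme \<Rightarrow> 'a set gorder" where
  "principal_lattice G = \<lparr>carrier = principal_l G ` carrier G, eq = (=), le = (\<subseteq>)\<rparr>"

definition Max_l :: "('a, 'b) lgroup_scheme \<Rightarrow> 'a set set" where
  "Max_l G = {m. convex_l_subgroup G m \<and> m \<noteq> carrier G \<and>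
     (\<forall>H. convex_l_subgroup G H \<longrightarrow> m \<subseteq> H \<longrightarrow> H \<noteq> carrier G \<longrightarrow> H = m)}"

definition Spec_l :: "('a, 'b) lgroup_scheme \<Rightarrow> 'a set set" where
  "Spec_l G = {p. convex_l_subgroup G p \<and> p \<noteq> carrier G \<and>
     (\<forall>a\<in>carrier G. \<forall>b\<in>carrier G. a \<sqinter>\<^bsub>lorder G\<^esub> b = \<one>\<^bsub>G\<^esub> \<longrightarrow> a \<in> p \<or> b \<in> p)}"

text \<open>Intersection of a family of subsets of \<open>G\<close>; the empty intersection is \<open>G\<close>.\<close>

definition Inter_l :: "('a, 'b) lgroup_scheme \<Rightarrow> 'a set set \<Rightarrow> 'a set" where
  "Inter_l G M = carrier G \<inter> \<Inter>M"

text \<open>\<open>G \<in> (Y)\<close>: in the frame of convex \<open>\<ell>\<close>-subgroups every compact element is a meet of maximal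
  elements.\<close>

definition yosida :: "('a, 'b) lgroup_scheme \<Rightarrow> bool" where
  "yosida G \<longleftrightarrow> (\<forall>a\<in>carrier G. \<exists>M \<subseteq> Max_l G. principal_l G a = Inter_l G M)"

definition enough_maximal :: "('a, 'b) lgroup_scheme \<Rightarrow> bool" where
  "enough_maximal G \<longleftrightarrow> Inter_l G (Max_l G) = {\<one>\<^bsub>G\<^esub>}"

text \<open>The quotient by a normal convex \<open>\<ell>\<close>-subgroup. Cosets satisfy \<open>A \<le> B\<close> iff they have
  representatives \<open>a \<le> b\<close>.\<close>

definition l_quotient :: "('a, 'b) lgroup_scheme \<Rightarrow> 'a set \<Rightarrow> 'a set lgroup" where
  "l_quotient G N = monoid.extend (G Mod N)
     \<lparr>lle = (\<lambda>A B. \<exists>a\<in>A. \<exists>b\<in>B. lle G a b)\<rparr>"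


definition order_ideal :: "('a, 'b) gorder_scheme \<Rightarrow> 'a set \<Rightarrow> bool" where
  "order_ideal L W \<longleftrightarrow> W \<subseteq> carrier L \<and> W \<noteq> {} \<and>
     (\<forall>x\<in>W. \<forall>y\<in>carrier L. y \<sqsubseteq>\<^bsub>L\<^esub> x \<longrightarrow> y \<in> W) \<and>
     (\<forall>x\<in>W. \<forall>y\<in>W. x \<squnion>\<^bsub>L\<^esub> y \<in> W)"

definition ideal_lattice :: "('a, 'b) gorder_scheme \<Rightarrow> 'a set gorder" where
  "ideal_lattice L = \<lparr>carrier = {W. order_ideal L W}, eq = (=), le = (\<subseteq>)\<rparr>"

definition principal_ideal :: "('a, 'b) gorder_scheme \<Rightarrow> 'a \<Rightarrow> 'a set" where
  "principal_ideal L b = {x \<in> carrier L. x \<sqsubseteq>\<^bsub>L\<^esub> b}"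

definition ideally_conjunctive :: "('a, 'b) gorder_scheme \<Rightarrow> bool" where
  "ideally_conjunctive L \<longleftrightarrow>
     (\<forall>a\<in>carrier L. \<forall>b\<in>carrier L. \<not> b \<sqsubseteq>\<^bsub>L\<^esub> a \<longrightarrow>
       (\<exists>W. order_ideal L W \<and> a \<in> W \<and> W \<noteq> carrier L \<and>
         W \<squnion>\<^bsub>ideal_lattice L\<^esub> principal_ideal L b = carrier L))"


text \<open>\<open>\<real>\<close> to the power \<open>X\<close> with pointwise operations and order. As usual for function spaces over
  a set, functions are taken to be \<open>undefined\<close> outside \<open>X\<close>.\<close>

definition real_power :: "'x set \<Rightarrow> ('x \<Rightarrow> real) lgroup" where
  "real_power X = \<lparr>carrier = X \<rightarrow>\<^sub>E UNIV, monoid.mult = (\<lambda>f g. \<lambda>x\<in>X. f x + g x),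
     one = (\<lambda>x\<in>X. 0), lle = (\<lambda>f g. \<forall>x\<in>X. f x \<le> g x)\<rparr>"

definition l_embedding ::
    "('a, 'b) lgroup_scheme \<Rightarrow> ('c, 'd) lgroup_scheme \<Rightarrow> ('a \<Rightarrow> 'c) \<Rightarrow> bool" where
  "l_embedding G K \<phi> \<longleftrightarrow> \<phi> \<in> hom G K \<and> inj_on \<phi> (carrier G) \<and>
     (\<forall>x\<in>carrier G. \<forall>y\<in>carrier G.
        \<phi> (x \<squnion>\<^bsub>lorder G\<^esub> y) = \<phi> x \<squnion>\<^bsub>lorder K\<^esub> \<phi> y \<and>
        \<phi> (x \<sqinter>\<^bsub>lorder G\<^esub> y) = \<phi> x \<sqinter>\<^bsub>lorder K\<^esub> \<phi> y)"

definition zeros_map :: "'x set \<Rightarrow> ('a \<Rightarrow> 'x \<Rightarrow> real) \<Rightarrow> 'a \<Rightarrow> 'x set" where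
  "zeros_map X \<phi> a = {x \<in> X. \<phi> a x = 0}"

definition zeros_max :: "'a set set \<Rightarrow> 'a \<Rightarrow> 'a set set" where
  "zeros_max M a = {m \<in> M. a \<in> m}"

text \<open>\<open>I(Z(a))\<close> for a zero-set map \<open>Z\<close>.\<close>

definition zero_hull :: "('a, 'b) lgroup_scheme \<Rightarrow> ('a \<Rightarrow> 'x set) \<Rightarrow> 'a \<Rightarrow> 'a set" where
  "zero_hull G Z a = {b \<in> carrier G. Z a \<subseteq> Z b}"

definition zero_representation ::
    "('a, 'b) lgroup_scheme \<Rightarrow> 'x set \<Rightarrow> ('a \<Rightarrow> 'x \<Rightarrow> real) \<Rightarrow> bool" where
  "zero_representation G X \<phi> \<longleftrightarrow> l_embedding G (real_power X) \<phi> \<and>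
     (\<forall>a\<in>carrier G. principal_l G a = zero_hull G (zeros_map X \<phi>) a)"

definition patch_topology :: "('a, 'b) lgroup_scheme \<Rightarrow> 'a set topology" where
  "patch_topology G = topology_generated_by
     {{p \<in> Spec_l G. a \<notin> p \<and> b \<in> p} | a b. a \<in> carrier G \<and> b \<in> carrier G}"


text \<open>
  An existential quantifier over index sets has to be confined to one type of indices. For an
  \<open>\<ell>\<close>-group on \<open>'a\<close>, index sets of type \<open>'a set set\<close> suffice: by the lemma
  \<open>zero_representation_reindex\<close> below, a representation over an index set of an arbitrary type
  yields one over such an index set, obtained by identifying indices \<open>x\<close> for which the maps
  \<open>a \<mapsto> \<phi> a x\<close> have the same kernel.
\<close>

lemma real_power_join:
  assumes "f \<in> X \<rightarrow>\<^sub>E UNIV" "g \<in> X \<rightarrow>\<^sub>E UNIV"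
  shows "f \<squnion>\<^bsub>lorder (real_power X)\<^esub> g = (\<lambda>x\<in>X. max (f x) (g x))"
proof -
  let ?L = "lorder (real_power X)" and ?h = "\<lambda>x\<in>X. max (f x) (g x)"
  have uniq: "s = ?h" if "least ?L s (Upper ?L {f, g})" for s
  proof -
    have hU: "?h \<in> Upper ?L {f, g}"
      using assms by (auto simp: Upper_def lorder_def real_power_def)
    have sU: "s \<in> Upper ?L {f, g}" and sh: "le ?L s ?h"
      using that hU by (auto simp: least_def)
    have sc: "s \<in> X \<rightarrow>\<^sub>E UNIV" "\<forall>x\<in>X. f x \<le> s x" "\<forall>x\<in>X. g x \<le> s x"
      using sU assms by (auto simp: Upper_def lorder_def real_power_def)
    show ?thesis
    proof (rule extensionalityI[of _ X])
      show "s \<in> extensional X" using sc(1) by (simp add: PiE_def)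
      show "?h \<in> extensional X" by simp
      fix x assume "x \<in> X"
      then show "s x = ?h x"
        using sc sh by (force simp: lorder_def real_power_def intro: antisym)
    qed
  qed
  moreover have "least ?L ?h (Upper ?L {f, g})"
    using assms by (auto simp: least_def Upper_def lorder_def real_power_def)
  ultimately show ?thesis
    unfolding join_def sup_def by (metis (no_types, lifting) someI_ex)
qed

lemma real_power_meet:
  assumes "f \<in> X \<rightarrow>\<^sub>E UNIV" "g \<in> X \<rightarrow>\<^sub>E UNIV"
  shows "f \<sqinter>\<^bsub>lorder (real_power X)\<^esub> g = (\<lambda>x\<in>X. min (f x) (g x))"
proof -
  let ?L = "lorder (real_power X)" and ?h = "\<lambda>x\<in>X. min (f x) (g x)"
  have uniq: "s = ?h" if "greatest ?L s (Lower ?L {f, g})" for s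
  proof -
    have hU: "?h \<in> Lower ?L {f, g}"
      using assms by (auto simp: Lower_def lorder_def real_power_def)
    have sU: "s \<in> Lower ?L {f, g}" and sh: "le ?L ?h s"
      using that hU by (auto simp: greatest_def)
    have sc: "s \<in> X \<rightarrow>\<^sub>E UNIV" "\<forall>x\<in>X. s x \<le> f x" "\<forall>x\<in>X. s x \<le> g x"
      using sU assms by (auto simp: Lower_def lorder_def real_power_def)
    show ?thesis
    proof (rule extensionalityI[of _ X])
      show "s \<in> extensional X" using sc(1) by (simp add: PiE_def)
      show "?h \<in> extensional X" by simp
      fix x assume "x \<in> X"
      then show "s x = ?h x"
        using sc sh by (force simp: lorder_def real_power_def intro: antisym)
    qed
  qed
  moreover have "greatest ?L ?h (Lower ?L {f, g})"
    using assms by (auto simp: greatest_def Lower_def lorder_def real_power_def)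
  ultimately show ?thesis
    unfolding meet_def inf_def by (metis (no_types, lifting) someI_ex)
qed

lemma l_embedding_real_power_iff:
  assumes "lgroup G"
  shows "l_embedding G (real_power X) \<phi> \<longleftrightarrow>
    (\<forall>a\<in>carrier G. \<phi> a \<in> X \<rightarrow>\<^sub>E UNIV) \<and>
    (\<forall>a\<in>carrier G. \<forall>b\<in>carrier G. \<forall>x\<in>X. \<phi> (a \<otimes>\<^bsub>G\<^esub> b) x = \<phi> a x + \<phi> b x \<and>
       \<phi> (a \<squnion>\<^bsub>lorder G\<^esub> b) x = max (\<phi> a x) (\<phi> b x) \<and>
       \<phi> (a \<sqinter>\<^bsub>lorder G\<^esub> b) x = min (\<phi> a x) (\<phi> b x)) \<and>
    (\<forall>a\<in>carrier G. (\<forall>x\<in>X. \<phi> a x = 0) \<longrightarrow> a = \<one>\<^bsub>G\<^esub>)" (is "?E \<longleftrightarrow> ?A \<and> ?B \<and> ?C")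
proof -
  interpret lgroup G by fact
  interpret L: lattice "lorder G" by (rule lattice_lorder)
  have closed: "a \<squnion>\<^bsub>lorder G\<^esub> b \<in> carrier G" "a \<sqinter>\<^bsub>lorder G\<^esub> b \<in> carrier G"
    if "a \<in> carrier G" "b \<in> carrier G" for a b
    using L.join_closed[of a b] L.meet_closed[of a b] that by (auto simp: lorder_def)
  have eqI: "f = (\<lambda>x\<in>X. h x) \<longleftrightarrow> (\<forall>x\<in>X. f x = h x)"
    if "f \<in> X \<rightarrow>\<^sub>E (UNIV::real set)" for f h
    using that by (auto intro!: extensionalityI[of _ X] simp: PiE_def)
  have ops: "\<phi> \<in> hom G (real_power X) \<and>
     (\<forall>x\<in>carrier G. \<forall>y\<in>carrier G.
        \<phi> (x \<squnion>\<^bsub>lorder G\<^esub> y) = \<phi> x \<squnion>\<^bsub>lorder (real_power X)\<^esub> \<phi> y \<and>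
        \<phi> (x \<sqinter>\<^bsub>lorder G\<^esub> y) = \<phi> x \<sqinter>\<^bsub>lorder (real_power X)\<^esub> \<phi> y) \<longleftrightarrow> ?A \<and> ?B"
    (is "?H \<longleftrightarrow> _")
  proof (cases ?A)
    case False
    then show ?thesis by (auto simp: hom_def real_power_def)
  next
    case True
    then have "\<phi> \<in> hom G (real_power X) \<longleftrightarrow>
      (\<forall>a\<in>carrier G. \<forall>b\<in>carrier G. \<forall>x\<in>X. \<phi> (a \<otimes>\<^bsub>G\<^esub> b) x = \<phi> a x + \<phi> b x)"
      by (auto simp: hom_def real_power_def eqI)
    with True show ?thesis
      by (auto simp: real_power_join real_power_meet eqI closed)
  qed
  have inj: "inj_on \<phi> (carrier G) \<longleftrightarrow> ?C" if ?A ?B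
  proof -
    have one: "\<phi> \<one>\<^bsub>G\<^esub> x = 0" if "x \<in> X" for x
    proof -
      have "\<phi> (\<one>\<^bsub>G\<^esub> \<otimes>\<^bsub>G\<^esub> \<one>\<^bsub>G\<^esub>) x = \<phi> \<one>\<^bsub>G\<^esub> x + \<phi> \<one>\<^bsub>G\<^esub> x"
        using \<open>?B\<close> that one_closed by blast
      then show ?thesis by simp
    qed
    show ?thesis
    proof
      assume inj: "inj_on \<phi> (carrier G)"
      show ?C
      proof (intro ballI impI)
        fix a assume a: "a \<in> carrier G" "\<forall>x\<in>X. \<phi> a x = 0"
        have "\<phi> a = \<phi> \<one>\<^bsub>G\<^esub>"
          using a one \<open>?A\<close> by (intro extensionalityI[of _ X]) (auto simp: PiE_def)
        then show "a = \<one>\<^bsub>G\<^esub>" using inj a by (auto dest: inj_onD)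
      qed
    next
      assume C: ?C
      show "inj_on \<phi> (carrier G)"
      proof (rule inj_onI)
        fix a b assume ab: "a \<in> carrier G" "b \<in> carrier G" "\<phi> a = \<phi> b"
        have "\<phi> (a \<otimes>\<^bsub>G\<^esub> inv\<^bsub>G\<^esub> b) x = 0" if "x \<in> X" for x
        proof -
          have "\<phi> (b \<otimes>\<^bsub>G\<^esub> inv\<^bsub>G\<^esub> b) x = \<phi> b x + \<phi> (inv\<^bsub>G\<^esub> b) x"
            using \<open>?B\<close> that ab by blast
          moreover have "\<phi> (a \<otimes>\<^bsub>G\<^esub> inv\<^bsub>G\<^esub> b) x = \<phi> a x + \<phi> (inv\<^bsub>G\<^esub> b) x"
            using \<open>?B\<close> that ab by blast
          ultimately show ?thesis using ab one that by simp
        qed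
        then have "a \<otimes>\<^bsub>G\<^esub> inv\<^bsub>G\<^esub> b = \<one>\<^bsub>G\<^esub>" using C ab by blast
        then show "a = b" using ab by (metis inv_closed inv_equality inv_inv)
      qed
    qed
  qed
  show ?thesis unfolding l_embedding_def using ops inj by blast
qed

lemma zero_representation_reindex:
  fixes G :: "('a, 'b) lgroup_scheme" and X :: "'x set" and \<phi> :: "'a \<Rightarrow> 'x \<Rightarrow> real"
  assumes G: "lgroup G" and rep: "zero_representation G X \<phi>"
  shows "\<exists>(Y :: 'a set set) \<psi>. zero_representation G Y \<psi>"
proof -
  define ker where "ker x = {a \<in> carrier G. \<phi> a x = 0}" for x
  define Y where "Y = ker ` X"
  define r where "r = inv_into X ker"
  define \<psi> where "\<psi> a = (\<lambda>y\<in>Y. \<phi> a (r y))" for a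
  have r: "r y \<in> X" "ker (r y) = y" if "y \<in> Y" for y
    using that by (auto simp: r_def Y_def inv_into_into f_inv_into_f)
  have all: "(\<forall>x\<in>X. \<phi> a x = 0 \<longrightarrow> \<phi> b x = 0) \<longleftrightarrow> (\<forall>y\<in>Y. \<phi> a (r y) = 0 \<longrightarrow> \<phi> b (r y) = 0)"
    (is "?l \<longleftrightarrow> ?r") if ab: "a \<in> carrier G" "b \<in> carrier G" for a b
  proof
    assume ?l then show ?r using r by blast
  next
    assume R: ?r
    show ?l
    proof (intro ballI impI)
      fix x assume x: "x \<in> X" "\<phi> a x = 0"
      then have y: "ker x \<in> Y" by (simp add: Y_def)
      have "ker (r (ker x)) = ker x" using r(2)[OF y] .
      then have eq: "\<phi> c (r (ker x)) = 0 \<longleftrightarrow> \<phi> c x = 0" if "c \<in> carrier G" for c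
        using that by (auto simp: ker_def set_eq_iff)
      show "\<phi> b x = 0" using R y eq ab x by blast
    qed
  qed
  have E: "l_embedding G (real_power X) \<phi>"
    and P: "\<And>a. a \<in> carrier G \<Longrightarrow> principal_l G a = zero_hull G (zeros_map X \<phi>) a"
    using rep by (auto simp: zero_representation_def)
  have hull: "zero_hull G (zeros_map Y \<psi>) a = zero_hull G (zeros_map X \<phi>) a"
    if "a \<in> carrier G" for a
    using all[OF that] by (auto simp: zero_hull_def zeros_map_def \<psi>_def)
  have "l_embedding G (real_power Y) \<psi>"
    unfolding l_embedding_real_power_iff[OF G]
  proof (intro conjI)
    show "\<forall>a\<in>carrier G. (\<forall>y\<in>Y. \<psi> a y = 0) \<longrightarrow> a = \<one>\<^bsub>G\<^esub>"
    proof (intro ballI impI)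
      fix a assume a: "a \<in> carrier G" "\<forall>y\<in>Y. \<psi> a y = 0"
      have "\<phi> a x = 0" if x: "x \<in> X" for x
      proof -
        have y: "ker x \<in> Y" using x by (simp add: Y_def)
        then have "a \<in> ker (r (ker x))" using a by (simp add: ker_def \<psi>_def)
        then show ?thesis unfolding r(2)[OF y] by (simp add: ker_def)
      qed
      then show "a = \<one>\<^bsub>G\<^esub>" using E a by (simp add: l_embedding_real_power_iff[OF G])
    qed
  qed (use E r in \<open>auto simp: l_embedding_real_power_iff[OF G] \<psi>_def\<close>)
  then have "zero_representation G Y \<psi>"
    using P hull by (simp add: zero_representation_def)
  then show ?thesis by blast
qed


text \<open>
  The quotient \<open>G / G(a)\<close> is a group only if \<open>G(a)\<close> is normal. For abelian \<open>G\<close> this is automatic.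
\<close>

lemma principal_l_normal_comm:
  assumes G: "lgroup G" and comm: "comm_group G" and a: "a \<in> carrier G"
  shows "principal_l G a \<lhd> G"
proof -
  interpret lgroup G by (rule G)
  interpret C: comm_group G by (rule comm)
  interpret L: lattice "lorder G" by (rule lattice_lorder)
  have refl: "lle G x x" if "x \<in> carrier G" for x
    using L.le_refl[of x] that by (simp add: lorder_def)
  have trans: "lle G x z"
    if "lle G x y" "lle G y z" "x \<in> carrier G" "y \<in> carrier G" "z \<in> carrier G" for x y z
    using L.le_trans[of x y z] that by (simp add: lorder_def)
  have mono: "lle G (x \<otimes>\<^bsub>G\<^esub> u) (y \<otimes>\<^bsub>G\<^esub> v)"
    if le: "lle G x y" "lle G u v"
      and c: "x \<in> carrier G" "y \<in> carrier G" "u \<in> carrier G" "v \<in> carrier G" for x y u v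
  proof -
    have "lle G (\<one>\<^bsub>G\<^esub> \<otimes>\<^bsub>G\<^esub> x \<otimes>\<^bsub>G\<^esub> u) (\<one>\<^bsub>G\<^esub> \<otimes>\<^bsub>G\<^esub> y \<otimes>\<^bsub>G\<^esub> u)"
      using le c by (intro lle_translate) auto
    moreover have "lle G (y \<otimes>\<^bsub>G\<^esub> u \<otimes>\<^bsub>G\<^esub> \<one>\<^bsub>G\<^esub>) (y \<otimes>\<^bsub>G\<^esub> v \<otimes>\<^bsub>G\<^esub> \<one>\<^bsub>G\<^esub>)"
      using le c by (intro lle_translate) auto
    ultimately show ?thesis using c trans[of "x \<otimes>\<^bsub>G\<^esub> u" "y \<otimes>\<^bsub>G\<^esub> u" "y \<otimes>\<^bsub>G\<^esub> v"] by simp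
  qed
  have absc: "l_abs G x \<in> carrier G" if "x \<in> carrier G" for x
    using L.join_closed[of x "inv\<^bsub>G\<^esub> x"] that by (simp add: l_abs_def lorder_def)
  have abs_iff: "lle G (l_abs G x) y \<longleftrightarrow> lle G x y \<and> lle G (inv\<^bsub>G\<^esub> x) y"
    if c: "x \<in> carrier G" "y \<in> carrier G" for x y
  proof
    assume le: "lle G (l_abs G x) y"
    have "lle G x (l_abs G x)" "lle G (inv\<^bsub>G\<^esub> x) (l_abs G x)"
      using L.join_left[of x "inv\<^bsub>G\<^esub> x"] L.join_right[of x "inv\<^bsub>G\<^esub> x"] c
      by (simp_all add: l_abs_def lorder_def)
    then show "lle G x y \<and> lle G (inv\<^bsub>G\<^esub> x) y"
      using le c absc[of x] trans[of x "l_abs G x" y] trans[of "inv\<^bsub>G\<^esub> x" "l_abs G x" y] by simp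
  next
    assume "lle G x y \<and> lle G (inv\<^bsub>G\<^esub> x) y"
    then show "lle G (l_abs G x) y"
      using L.join_le[of x y "inv\<^bsub>G\<^esub> x"] c by (simp add: l_abs_def lorder_def)
  qed
  have mem: "b \<in> principal_l G a \<longleftrightarrow> b \<in> carrier G \<and>
      (\<exists>n::nat. lle G b (l_abs G a [^]\<^bsub>G\<^esub> n) \<and> lle G (inv\<^bsub>G\<^esub> b) (l_abs G a [^]\<^bsub>G\<^esub> n))" for b
    using abs_iff absc[OF a] by (auto simp: principal_l_def)
  have "subgroup (principal_l G a) G"
  proof (rule subgroupI)
    show "principal_l G a \<subseteq> carrier G" by (auto simp: principal_l_def)
    have "\<one>\<^bsub>G\<^esub> \<in> principal_l G a"
      unfolding mem by (auto intro!: exI[of _ 0] refl)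
    then show "principal_l G a \<noteq> {}" by blast
    show "inv\<^bsub>G\<^esub> b \<in> principal_l G a" if "b \<in> principal_l G a" for b
      using that unfolding mem by auto
    show "b \<otimes>\<^bsub>G\<^esub> c \<in> principal_l G a" if bc: "b \<in> principal_l G a" "c \<in> principal_l G a" for b c
    proof -
      obtain m n :: nat where m: "b \<in> carrier G" "lle G b (l_abs G a [^]\<^bsub>G\<^esub> m)"
          "lle G (inv\<^bsub>G\<^esub> b) (l_abs G a [^]\<^bsub>G\<^esub> m)"
        and n: "c \<in> carrier G" "lle G c (l_abs G a [^]\<^bsub>G\<^esub> n)"
          "lle G (inv\<^bsub>G\<^esub> c) (l_abs G a [^]\<^bsub>G\<^esub> n)"
        using bc unfolding mem by blast
      have "lle G (b \<otimes>\<^bsub>G\<^esub> c) (l_abs G a [^]\<^bsub>G\<^esub> (m + n))"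
        "lle G (inv\<^bsub>G\<^esub> (b \<otimes>\<^bsub>G\<^esub> c)) (l_abs G a [^]\<^bsub>G\<^esub> (m + n))"
        using m n absc[OF a] mono by (simp_all add: nat_pow_mult[symmetric] C.inv_mult)
      then show ?thesis using m n unfolding mem by blast
    qed
  qed
  then show ?thesis by (rule C.subgroup_imp_normal)
qed

end

theory Submission
  imports Defs
begin

text \<open>
  All conditions say that membership in every maximal convex subgroup containing \<open>a\<close> forces membership
  in \<open>G(a)\<close>. Ideals of the lattice of principal subgroups correspond to convex subgroups. A
  convex subgroup that is maximal without containing \<open>b\<close> (a value of \<open>b\<close>), which exists by
  Zorn's lemma, is prime. Since all \<open>G(a)\<close> are normal, so are all convex subgroups, and the
  quotient by a maximal one is totally ordered and archimedean. A version of Hoelder's theorem for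
  total preorders, which needs no commutativity, embeds it into the reals. Conversely, the kernel of
  a homomorphism to the reals is maximal or everything, also after restriction to a subgroup, which
  makes the condition hereditary.
\<close>

subsection \<open>Archimedean preordered groups\<close>

text \<open>Two devices replace commutativity. Normality lets the convex subgroup generated by a
  convex \<open>N\<close> and an element \<open>x\<close> be described by bounds
  \<open>h \<otimes> |x|^n\<close> with \<open>h\<close> in \<open>N\<close>, since conjugation
  moves every factor from \<open>N\<close> to the left; this description yields both the primality
  of values and the archimedean property. In Hoelder's theorem \<open>(a b)^n\<close> is squeezed
  between \<open>a^n b^n\<close> and \<open>b^n a^n\<close> in one order or the other, so the real
  value of a product differs from the sum of the values by at most \<open>2/n\<close> for every
  \<open>n\<close>, which forces additivity. The order is only a preorder so that it can live on
  \<open>G\<close> itself: lying below each other means being congruent modulo the maximal subgroup,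
  and no quotient has to be formed for the representation. Heredity is routed through real functions
  because a homomorphism restricts to a subgroup at once, whereas maximality of the intersection
  with a subgroup is not visible from the definition.\<close>

locale archimedean_preordered_group = group G for G (structure) +
  fixes R :: "'a \<Rightarrow> 'a \<Rightarrow> bool" (infix "\<trianglelefteq>" 50)
  assumes total: "\<lbrakk>x \<in> carrier G; y \<in> carrier G\<rbrakk> \<Longrightarrow> x \<trianglelefteq> y \<or> y \<trianglelefteq> x"
    and trans: "\<lbrakk>x \<trianglelefteq> y; y \<trianglelefteq> z; x \<in> carrier G; y \<in> carrier G; z \<in> carrier G\<rbrakk> \<Longrightarrow> x \<trianglelefteq> z"
    and translate: "\<lbrakk>x \<trianglelefteq> y; x \<in> carrier G; y \<in> carrier G; u \<in> carrier G; v \<in> carrier G\<rbrakk>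
      \<Longrightarrow> u \<otimes> x \<otimes> v \<trianglelefteq> u \<otimes> y \<otimes> v"
    and archimedean: "\<lbrakk>u \<in> carrier G; b \<in> carrier G; \<not> u \<trianglelefteq> \<one>\<rbrakk> \<Longrightarrow> \<exists>n::nat. b \<trianglelefteq> u [^] n"
begin

lemma refl: "x \<in> carrier G \<Longrightarrow> x \<trianglelefteq> x"
  using total by blast

lemma mult_mono:
  assumes "x \<trianglelefteq> y" "z \<trianglelefteq> w" "x \<in> carrier G" "y \<in> carrier G" "z \<in> carrier G" "w \<in> carrier G"
  shows "x \<otimes> z \<trianglelefteq> y \<otimes> w"
proof (rule trans[of _ "y \<otimes> z"])
  show "x \<otimes> z \<trianglelefteq> y \<otimes> z" using translate[of x y \<one> z] assms by simp
  show "y \<otimes> z \<trianglelefteq> y \<otimes> w" using translate[of z w y \<one>] assms by simp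
qed (use assms in auto)

lemma inv_le: "x \<trianglelefteq> y \<longleftrightarrow> inv y \<trianglelefteq> inv x" if "x \<in> carrier G" "y \<in> carrier G"
  using translate[of x y "inv x" "inv y"] translate[of "inv y" "inv x" x y] that by (auto simp: m_assoc)

lemma mult_inv_le: "x \<trianglelefteq> y \<longleftrightarrow> x \<otimes> inv y \<trianglelefteq> \<one>" if "x \<in> carrier G" "y \<in> carrier G"
  using translate[of x y \<one> "inv y"] translate[of "x \<otimes> inv y" \<one> \<one> y] that by (auto simp: m_assoc)

lemma nat_pow_mono: "x \<trianglelefteq> y \<Longrightarrow> x \<in> carrier G \<Longrightarrow> y \<in> carrier G \<Longrightarrow> x [^] (n::nat) \<trianglelefteq> y [^] n"
  by (induction n) (simp_all add: refl mult_mono)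

text \<open>Induction by peeling off the outer factors:
  \<open>a^(n+1) b^(n+1) = a (a^n b^n) b\<close> is below \<open>a (a b)^n b\<close>, hence below
  \<open>a (b a)^n b = (a b)^(n+1)\<close> by the assumed comparison. The second half is the mirror
  image.\<close>

lemma nat_pow_mult_between:
  assumes "a \<in> carrier G" "b \<in> carrier G" "a \<otimes> b \<trianglelefteq> b \<otimes> a"
  shows "a [^] (n::nat) \<otimes> b [^] n \<trianglelefteq> (a \<otimes> b) [^] n \<and> (b \<otimes> a) [^] n \<trianglelefteq> b [^] n \<otimes> a [^] n"
proof (induction n)
  case 0
  then show ?case by (simp add: refl)
next
  case (Suc n)
  have shift: "x \<otimes> (y \<otimes> x) [^] n \<otimes> y = (x \<otimes> y) [^] Suc n"
    if "x \<in> carrier G" "y \<in> carrier G" for x y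
  proof (induction n)
    case (Suc k)
    have "x \<otimes> (y \<otimes> x) [^] Suc k \<otimes> y = (x \<otimes> (y \<otimes> x) [^] k \<otimes> y) \<otimes> (x \<otimes> y)"
      using that by (simp add: m_assoc)
    then show ?case using Suc that by simp
  qed (use that in simp)
  have split: "x [^] Suc n \<otimes> y [^] Suc n = x \<otimes> (x [^] n \<otimes> y [^] n) \<otimes> y"
    if "x \<in> carrier G" "y \<in> carrier G" for x y
    using that nat_pow_Suc2[of x n] by (simp add: m_assoc del: nat_pow_Suc)
  have p: "(a \<otimes> b) [^] n \<trianglelefteq> (b \<otimes> a) [^] n" using assms by (intro nat_pow_mono) auto
  have "a [^] Suc n \<otimes> b [^] Suc n \<trianglelefteq> (a \<otimes> b) [^] Suc n"
    unfolding split[OF assms(1,2)] shift[OF assms(1,2), symmetric]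
    using Suc p assms by (intro translate trans[OF _ p]) auto
  moreover have "(b \<otimes> a) [^] Suc n \<trianglelefteq> b [^] Suc n \<otimes> a [^] Suc n"
    unfolding split[OF assms(2,1)] shift[OF assms(2,1), symmetric]
    using Suc p assms by (intro translate trans[OF p]) auto
  ultimately show ?case ..
qed

text \<open>A form that does not depend on which of \<open>a \<otimes> b\<close> and
  \<open>b \<otimes> a\<close> is smaller. The disjunctions are harmless later, because bounds of
  \<open>a^n\<close> and \<open>b^n\<close> by powers of one \<open>u\<close> multiply to the same
  power of \<open>u\<close> in either order.\<close>

lemma nat_pow_mult_le:
  assumes "a \<in> carrier G" "b \<in> carrier G"
  shows "(a \<otimes> b) [^] (n::nat) \<trianglelefteq> a [^] n \<otimes> b [^] n \<or> (a \<otimes> b) [^] n \<trianglelefteq> b [^] n \<otimes> a [^] n"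
    and "a [^] (n::nat) \<otimes> b [^] n \<trianglelefteq> (a \<otimes> b) [^] n \<or> b [^] n \<otimes> a [^] n \<trianglelefteq> (a \<otimes> b) [^] n"
proof -
  have *: "x [^] n \<otimes> y [^] n \<trianglelefteq> (x \<otimes> y) [^] n \<and> (x \<otimes> y) [^] n \<trianglelefteq> y [^] n \<otimes> x [^] n
    \<and> x [^] n \<otimes> y [^] n \<trianglelefteq> (y \<otimes> x) [^] n \<and> (y \<otimes> x) [^] n \<trianglelefteq> y [^] n \<otimes> x [^] n"
    if "x \<otimes> y \<trianglelefteq> y \<otimes> x" "x \<in> carrier G" "y \<in> carrier G" for x y
  proof -
    have "(x \<otimes> y) [^] n \<trianglelefteq> (y \<otimes> x) [^] n" using that by (intro nat_pow_mono) auto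
    then show ?thesis
      using nat_pow_mult_between[of x y n] that
      by (auto intro: trans[of _ "(y \<otimes> x) [^] n"] trans[of _ "(x \<otimes> y) [^] n"])
  qed
  consider "a \<otimes> b \<trianglelefteq> b \<otimes> a" | "b \<otimes> a \<trianglelefteq> a \<otimes> b" using total assms by blast
  then show "(a \<otimes> b) [^] (n::nat) \<trianglelefteq> a [^] n \<otimes> b [^] n \<or> (a \<otimes> b) [^] n \<trianglelefteq> b [^] n \<otimes> a [^] n"
    "a [^] (n::nat) \<otimes> b [^] n \<trianglelefteq> (a \<otimes> b) [^] n \<or> b [^] n \<otimes> a [^] n \<trianglelefteq> (a \<otimes> b) [^] n"
    using *[of a b] *[of b a] assms by blast+
qed

text \<open>If \<open>u^k\<close> were below \<open>u^l\<close> with \<open>l < k\<close>, then so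
  would be \<open>u^(l+1)\<close>, and multiplying by \<open>u^(-l)\<close> would put
  \<open>u\<close> below \<open>\<one>\<close>.\<close>

lemma int_pow_le_iff:
  assumes u: "u \<in> carrier G" "\<not> u \<trianglelefteq> \<one>"
  shows "u [^] (k::int) \<trianglelefteq> u [^] (l::int) \<longleftrightarrow> k \<le> l"
proof -
  have one: "\<one> \<trianglelefteq> u" using total u by blast
  have pos: "\<one> \<trianglelefteq> u [^] n" for n :: nat
    by (induction n) (use u one refl mult_mono[of \<one> _ \<one> u] in auto)
  have mono: "u [^] k \<trianglelefteq> u [^] l" if "k \<le> l" for k l :: int
  proof -
    have "u [^] l = u [^] k \<otimes> u [^] nat (l - k)"
      using that u int_pow_mult[of u k "l - k"] by (simp add: int_pow_int[symmetric])
    then show ?thesis using mult_mono[of "u [^] k" "u [^] k" \<one> "u [^] nat (l - k)"] u pos refl by simp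
  qed
  moreover have False if "u [^] k \<trianglelefteq> u [^] l" "l < k" for k l :: int
  proof -
    have "u [^] (l + 1) \<trianglelefteq> u [^] l"
      using mono[of "l + 1" k] that u trans[of "u [^] (l + 1)" "u [^] k" "u [^] l"] by simp
    then have "u [^] (- l) \<otimes> u [^] (l + 1) \<trianglelefteq> u [^] (- l) \<otimes> u [^] l"
      using u by (intro mult_mono refl) auto
    then show False using u by (simp flip: int_pow_mult)
  qed
  ultimately show ?thesis by (meson not_le)
qed

lemma int_pow_bracket:
  assumes u: "u \<in> carrier G" "\<not> u \<trianglelefteq> \<one>" and b: "b \<in> carrier G"
  obtains k :: int where "u [^] k \<trianglelefteq> b" "b \<trianglelefteq> u [^] (k + 1)"
proof -
  obtain M :: nat where M: "inv b \<trianglelefteq> u [^] M" using archimedean u b by blast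
  have lo: "u [^] (- int M) \<trianglelefteq> b"
    using M inv_le[of "inv b" "u [^] M"] u b by (simp add: int_pow_neg_int)
  obtain N :: nat where N: "b \<trianglelefteq> u [^] N" using archimedean u b by blast
  \<comment> \<open>Counting exponents upwards from \<open>- M\<close>, where \<open>u^(-M)\<close>
    is already below \<open>b\<close>, turns the search for the first power above \<open>b\<close>
    into a \<open>LEAST\<close> over the naturals.\<close>
  define j where "j = (LEAST j. b \<trianglelefteq> u [^] (int j - int M))"
  have hi: "b \<trianglelefteq> u [^] (int (N + M) - int M)" using N by (simp add: int_pow_int)
  have j: "b \<trianglelefteq> u [^] (int j - int M)" unfolding j_def by (rule LeastI, rule hi)
  show thesis
  proof (cases j)
    case 0
    show thesis
    proof (rule that)
      show "u [^] (- int M) \<trianglelefteq> b" by (rule lo)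
      \<comment> \<open>No exponent below \<open>- M\<close> is inspected, so the upper end of the
        bracket is obtained by weakening the bound \<open>u^(-M)\<close> by one step.\<close>
      have "u [^] (int j - int M) \<trianglelefteq> u [^] (- int M + 1)" using 0 u by (simp add: int_pow_le_iff)
      then show "b \<trianglelefteq> u [^] (- int M + 1)" using j trans u b by blast
    qed
  next
    case (Suc i)
    then have "\<not> b \<trianglelefteq> u [^] (int i - int M)" unfolding j_def by (metis lessI not_less_Least)
    then show thesis
      using that[of "int i - int M"] total[of b "u [^] (int i - int M)"] j u b Suc
      by (simp add: algebra_simps)
  qed
qed

lemma int_pow_nat_pow_commute: "(u [^] (k::int)) [^] (n::nat) = u [^] (k * int n)"
  if "u \<in> carrier G"
  using int_pow_pow[OF that, of k "int n"] by (simp add: int_pow_int)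

text \<open>Hoelder's construction: \<open>\<phi> b\<close> measures \<open>b\<close> in units of a
  fixed \<open>u\<close> strictly above \<open>\<one>\<close>, as the supremum of the rationals
  \<open>k / n\<close> for which \<open>u^k\<close> is below \<open>b^n\<close>.\<close>

theorem ex_real_hom:
  obtains \<phi> :: "'a \<Rightarrow> real" where
    "\<And>x y. x \<in> carrier G \<Longrightarrow> y \<in> carrier G \<Longrightarrow> \<phi> (x \<otimes> y) = \<phi> x + \<phi> y"
    "\<And>x y. x \<in> carrier G \<Longrightarrow> y \<in> carrier G \<Longrightarrow> x \<trianglelefteq> y \<longleftrightarrow> \<phi> x \<le> \<phi> y"
proof (cases "\<exists>u\<in>carrier G. \<not> u \<trianglelefteq> \<one>")
  \<comment> \<open>Nothing lies strictly above \<open>\<one>\<close>, so any two elements lie below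
    each other and the zero map reflects the order.\<close>
  case False
  then have "x \<trianglelefteq> y" if "x \<in> carrier G" "y \<in> carrier G" for x y
    using mult_inv_le[of x y] that by blast
  then show ?thesis using that[of "\<lambda>_. 0"] by auto
next
  case True
  then obtain u where u: "u \<in> carrier G" "\<not> u \<trianglelefteq> \<one>" by blast
  define S where "S b = {real_of_int k / real n |k n. n > 0 \<and> u [^] (k::int) \<trianglelefteq> b [^] (n::nat)}" for b
  define \<phi> where "\<phi> b = Sup (S b)" for b
  \<comment> \<open>A lower and an upper rational estimate of the same \<open>b\<close> are compared
    at the common exponent \<open>m * n\<close>; since powers of \<open>u\<close> are strictly
    increasing, this becomes an inequality of integers.\<close>
  have cut: "real_of_int l / real m \<le> real_of_int k / real n"
    if "b \<in> carrier G" "m > 0" "n > 0" "u [^] l \<trianglelefteq> b [^] m" "b [^] n \<trianglelefteq> u [^] k"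
    for b and k l :: int and m n :: nat
  proof -
    have "u [^] (l * int n) \<trianglelefteq> b [^] (m * n)"
      using nat_pow_mono[OF that(4), of n] that(1) u by (simp add: int_pow_nat_pow_commute nat_pow_pow)
    moreover have "b [^] (m * n) \<trianglelefteq> u [^] (k * int m)"
      using nat_pow_mono[OF that(5), of m] that(1) u
      by (simp add: int_pow_nat_pow_commute nat_pow_pow mult.commute)
    ultimately have "u [^] (l * int n) \<trianglelefteq> u [^] (k * int m)" using that(1) u by (blast intro: trans)
    then have "l * int n \<le> k * int m" using u by (simp add: int_pow_le_iff)
    then have "real_of_int l * real n \<le> real_of_int k * real m"
      by (metis of_int_le_iff of_int_mult of_int_of_nat_eq)
    then show ?thesis using that by (simp add: field_simps)
  qed
  have ne: "S b \<noteq> {}" and bdd: "bdd_above (S b)" if b: "b \<in> carrier G" for b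
  proof -
    obtain k :: int where k: "u [^] k \<trianglelefteq> b" "b \<trianglelefteq> u [^] (k + 1)" using int_pow_bracket u b by blast
    then have "real_of_int k / real 1 \<in> S b" unfolding S_def using b
      by (intro CollectI exI[of _ k] exI[of _ 1]) auto
    then show "S b \<noteq> {}" by blast
    show "bdd_above (S b)" unfolding bdd_above_def S_def
      using cut[OF b, of _ 1 _ "k + 1"] k b by auto
  qed
  have lower: "real_of_int k \<le> real n * \<phi> b"
    if "b \<in> carrier G" "u [^] k \<trianglelefteq> b [^] n" "n > 0" for b k n
  proof -
    have "real_of_int k / real n \<le> \<phi> b" unfolding \<phi>_def
      using that by (intro cSup_upper bdd) (auto simp: S_def)
    then show ?thesis using that by (simp add: field_simps)
  qed
  have upper: "real n * \<phi> b \<le> real_of_int k"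
    if "b \<in> carrier G" "b [^] n \<trianglelefteq> u [^] k" "n > 0" for b k n
  proof -
    have "\<phi> b \<le> real_of_int k / real n" unfolding \<phi>_def
      using that cut by (intro cSup_least ne) (auto simp: S_def)
    then show ?thesis using that by (simp add: field_simps)
  qed
  have add: "\<phi> (a \<otimes> b) = \<phi> a + \<phi> b" if ab: "a \<in> carrier G" "b \<in> carrier G" for a b
  proof -
    \<comment> \<open>If \<open>u^k\<close>, \<open>u^(k+1)\<close> bracket \<open>a^n\<close> and
      \<open>u^l\<close>, \<open>u^(l+1)\<close> bracket \<open>b^n\<close>, then both
      \<open>n * \<phi> (a \<otimes> b)\<close> and \<open>n * \<phi> a + n * \<phi> b\<close> lie
      between \<open>k + l\<close> and \<open>k + l + 2\<close>.\<close>
    have bound: "\<bar>\<phi> (a \<otimes> b) - \<phi> a - \<phi> b\<bar> * real n \<le> 2" if n: "n > 0" for n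
    proof -
      obtain k :: int where k: "u [^] k \<trianglelefteq> a [^] n" "a [^] n \<trianglelefteq> u [^] (k + 1)"
        using int_pow_bracket[OF u] ab by blast
      obtain l :: int where l: "u [^] l \<trianglelefteq> b [^] n" "b [^] n \<trianglelefteq> u [^] (l + 1)"
        using int_pow_bracket[OF u] ab by blast
      have "u [^] (k + l) \<trianglelefteq> a [^] n \<otimes> b [^] n"
        using mult_mono[OF k(1) l(1)] ab u by (simp add: int_pow_mult)
      moreover have "u [^] (k + l) \<trianglelefteq> b [^] n \<otimes> a [^] n"
        using mult_mono[OF l(1) k(1)] ab u by (simp add: add.commute[of k] int_pow_mult)
      ultimately have lo: "u [^] (k + l) \<trianglelefteq> (a \<otimes> b) [^] n"
        using nat_pow_mult_le(2)[OF ab, of n] ab u by (blast intro: trans)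
      have "a [^] n \<otimes> b [^] n \<trianglelefteq> u [^] ((k + 1) + (l + 1))"
        using mult_mono[OF k(2) l(2)] ab u by (simp only: int_pow_mult) simp
      moreover have "b [^] n \<otimes> a [^] n \<trianglelefteq> u [^] ((l + 1) + (k + 1))"
        using mult_mono[OF l(2) k(2)] ab u by (simp only: int_pow_mult) simp
      ultimately have "a [^] n \<otimes> b [^] n \<trianglelefteq> u [^] (k + l + 2)" "b [^] n \<otimes> a [^] n \<trianglelefteq> u [^] (k + l + 2)"
        by (simp_all add: algebra_simps)
      then have hi: "(a \<otimes> b) [^] n \<trianglelefteq> u [^] (k + l + 2)"
        using nat_pow_mult_le(1)[OF ab, of n] ab u by (blast intro: trans)
      have "real_of_int k \<le> real n * \<phi> a" "real n * \<phi> a \<le> real_of_int (k + 1)"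
        "real_of_int l \<le> real n * \<phi> b" "real n * \<phi> b \<le> real_of_int (l + 1)"
        "real_of_int (k + l) \<le> real n * \<phi> (a \<otimes> b)" "real n * \<phi> (a \<otimes> b) \<le> real_of_int (k + l + 2)"
        using lower upper k l lo hi ab n by (blast intro: m_closed)+
      then have "\<bar>real n * \<phi> (a \<otimes> b) - real n * \<phi> a - real n * \<phi> b\<bar> \<le> 2" by (simp add: abs_le_iff)
      moreover have "real n * \<phi> (a \<otimes> b) - real n * \<phi> a - real n * \<phi> b
          = (\<phi> (a \<otimes> b) - \<phi> a - \<phi> b) * real n" by (simp add: algebra_simps)
      ultimately show ?thesis by (simp add: abs_mult)
    qed
    show ?thesis
    proof (rule ccontr)
      assume "\<phi> (a \<otimes> b) \<noteq> \<phi> a + \<phi> b"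
      then have pos: "\<bar>\<phi> (a \<otimes> b) - \<phi> a - \<phi> b\<bar> > 0" by simp
      then obtain n where n: "2 < real n * \<bar>\<phi> (a \<otimes> b) - \<phi> a - \<phi> b\<bar>"
        using reals_Archimedean3 by blast
      then have "n > 0" using gr0I by fastforce
      then show False using bound[of n] n by (simp add: mult.commute)
    qed
  qed
  have ge: "\<phi> x \<le> \<phi> y" if "x \<in> carrier G" "y \<in> carrier G" "x \<trianglelefteq> y" for x y
  proof -
    have "S x \<subseteq> S y"
      unfolding S_def using nat_pow_mono[OF that(3,1,2)] that u by (auto intro: trans)
    then show ?thesis unfolding \<phi>_def using ne bdd that by (intro cSup_subset_mono) auto
  qed
  have less: "\<phi> y < \<phi> x" if "x \<in> carrier G" "y \<in> carrier G" "\<not> x \<trianglelefteq> y" for x y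
  proof -
    let ?d = "x \<otimes> inv y"
    have d: "?d \<in> carrier G" "\<not> ?d \<trianglelefteq> \<one>" using mult_inv_le[of x y] that by blast+
    \<comment> \<open>The archimedean property is what makes \<open>\<phi>\<close> strict: some
      power of \<open>?d\<close> reaches the unit \<open>u\<close>, so \<open>n * \<phi> ?d\<close>
      is at least 1.\<close>
    obtain n :: nat where n: "u \<trianglelefteq> ?d [^] n"
      using archimedean[of ?d u] d u by blast
    have "n \<noteq> 0" using n u by (intro notI) simp
    then have "real_of_int 1 \<le> real n * \<phi> ?d"
      using n that u by (intro lower) auto
    then have "0 < real n * \<phi> ?d" by simp
    then have "0 < \<phi> ?d" by (simp add: zero_less_mult_iff)
    moreover have "\<phi> x = \<phi> ?d + \<phi> y" using add[of ?d y] that by (simp add: m_assoc)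
    ultimately show ?thesis by simp
  qed
  show ?thesis
    by (rule that[of \<phi>]) (use add ge less in \<open>force simp: not_le\<close>)+
qed

end

subsection \<open>Arithmetic of lattice-ordered groups\<close>

context lgroup
begin

abbreviation le_l (infix "\<preceq>" 50) where "x \<preceq> y \<equiv> lle G x y"
abbreviation join_l (infixl "\<curlyvee>" 65) where "x \<curlyvee> y \<equiv> x \<squnion>\<^bsub>lorder G\<^esub> y"
abbreviation meet_l (infixl "\<curlywedge>" 65) where "x \<curlywedge> y \<equiv> x \<sqinter>\<^bsub>lorder G\<^esub> y"

context
begin

interpretation L: lattice "lorder G"
  rewrites "carrier (lorder G) = carrier G" and "le (lorder G) = lle G" and "eq (lorder G) = (=)"
  by (rule lattice_lorder) (simp_all add: lorder_def)

lemma le_refl [simp, intro]: "x \<in> carrier G \<Longrightarrow> x \<preceq> x"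
  by (rule L.le_refl)

lemma le_trans: "\<lbrakk>x \<preceq> y; y \<preceq> z; x \<in> carrier G; y \<in> carrier G; z \<in> carrier G\<rbrakk> \<Longrightarrow> x \<preceq> z"
  by (rule L.le_trans)

lemma le_antisym: "\<lbrakk>x \<preceq> y; y \<preceq> x; x \<in> carrier G; y \<in> carrier G\<rbrakk> \<Longrightarrow> x = y"
  by (rule L.le_antisym)

lemma join_closed [simp, intro]: "\<lbrakk>x \<in> carrier G; y \<in> carrier G\<rbrakk> \<Longrightarrow> x \<curlyvee> y \<in> carrier G"
  and meet_closed [simp, intro]: "\<lbrakk>x \<in> carrier G; y \<in> carrier G\<rbrakk> \<Longrightarrow> x \<curlywedge> y \<in> carrier G"
  by (rule L.join_closed L.meet_closed; assumption)+

lemma join_ge1 [simp, intro]: "\<lbrakk>x \<in> carrier G; y \<in> carrier G\<rbrakk> \<Longrightarrow> x \<preceq> x \<curlyvee> y"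
  and join_ge2 [simp, intro]: "\<lbrakk>x \<in> carrier G; y \<in> carrier G\<rbrakk> \<Longrightarrow> y \<preceq> x \<curlyvee> y"
  and meet_le1 [simp, intro]: "\<lbrakk>x \<in> carrier G; y \<in> carrier G\<rbrakk> \<Longrightarrow> x \<curlywedge> y \<preceq> x"
  and meet_le2 [simp, intro]: "\<lbrakk>x \<in> carrier G; y \<in> carrier G\<rbrakk> \<Longrightarrow> x \<curlywedge> y \<preceq> y"
  by (rule L.join_left L.join_right L.meet_left L.meet_right; assumption)+

lemma join_least: "\<lbrakk>x \<preceq> z; y \<preceq> z; x \<in> carrier G; y \<in> carrier G; z \<in> carrier G\<rbrakk> \<Longrightarrow> x \<curlyvee> y \<preceq> z"
  by (rule L.join_le)

lemma meet_greatest: "\<lbrakk>z \<preceq> x; z \<preceq> y; x \<in> carrier G; y \<in> carrier G; z \<in> carrier G\<rbrakk> \<Longrightarrow> z \<preceq> x \<curlywedge> y"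
  by (rule L.meet_le)

end

lemma join_eqI:
  "\<lbrakk>x \<preceq> s; y \<preceq> s; \<And>t. \<lbrakk>t \<in> carrier G; x \<preceq> t; y \<preceq> t\<rbrakk> \<Longrightarrow> s \<preceq> t;
    x \<in> carrier G; y \<in> carrier G; s \<in> carrier G\<rbrakk> \<Longrightarrow> x \<curlyvee> y = s"
  by (intro le_antisym join_least) auto

lemma meet_eqI:
  "\<lbrakk>s \<preceq> x; s \<preceq> y; \<And>t. \<lbrakk>t \<in> carrier G; t \<preceq> x; t \<preceq> y\<rbrakk> \<Longrightarrow> t \<preceq> s;
    x \<in> carrier G; y \<in> carrier G; s \<in> carrier G\<rbrakk> \<Longrightarrow> x \<curlywedge> y = s"
  by (rule le_antisym) (auto intro: meet_greatest)

lemma mult_mono: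
  assumes "x \<preceq> y" "z \<preceq> w" "x \<in> carrier G" "y \<in> carrier G" "z \<in> carrier G" "w \<in> carrier G"
  shows "x \<otimes> z \<preceq> y \<otimes> w"
proof (rule le_trans[of _ "y \<otimes> z"])
  show "x \<otimes> z \<preceq> y \<otimes> z" using lle_translate[of x y \<one> z] assms by simp
  show "y \<otimes> z \<preceq> y \<otimes> w" using lle_translate[of z w y \<one>] assms by simp
qed (use assms in auto)

lemma mult_le_cancel_left: "u \<otimes> x \<preceq> u \<otimes> y \<longleftrightarrow> x \<preceq> y"
  if "x \<in> carrier G" "y \<in> carrier G" "u \<in> carrier G"
  using lle_translate[of x y u \<one>] lle_translate[of "u \<otimes> x" "u \<otimes> y" "inv u" \<one>] that
  by (auto simp: m_assoc[symmetric])

lemma mult_le_cancel_right: "x \<otimes> u \<preceq> y \<otimes> u \<longleftrightarrow> x \<preceq> y"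
  if "x \<in> carrier G" "y \<in> carrier G" "u \<in> carrier G"
  using lle_translate[of x y \<one> u] lle_translate[of "x \<otimes> u" "y \<otimes> u" \<one> "inv u"] that
  by (auto simp: m_assoc)

lemma inv_le_iff: "inv y \<preceq> inv x \<longleftrightarrow> x \<preceq> y" if "x \<in> carrier G" "y \<in> carrier G"
  using lle_translate[of x y "inv x" "inv y"] lle_translate[of "inv y" "inv x" x y] that
  by (auto simp: m_assoc)

lemma le_mult_inv: "x \<preceq> z \<otimes> inv y \<longleftrightarrow> x \<otimes> y \<preceq> z"
  if "x \<in> carrier G" "y \<in> carrier G" "z \<in> carrier G"
  using mult_le_cancel_right[of x "z \<otimes> inv y" y] that by (simp add: m_assoc)

lemma mult_inv_le: "x \<otimes> inv y \<preceq> z \<longleftrightarrow> x \<preceq> z \<otimes> y"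
  if "x \<in> carrier G" "y \<in> carrier G" "z \<in> carrier G"
  using mult_le_cancel_right[of "x \<otimes> inv y" z y] that by (simp add: m_assoc)

lemma le_inv_mult: "x \<preceq> inv y \<otimes> z \<longleftrightarrow> y \<otimes> x \<preceq> z"
  if "x \<in> carrier G" "y \<in> carrier G" "z \<in> carrier G"
  using mult_le_cancel_left[of x "inv y \<otimes> z" y] that by (simp add: m_assoc[symmetric])

lemma one_le_mult: "\<lbrakk>\<one> \<preceq> x; \<one> \<preceq> y; x \<in> carrier G; y \<in> carrier G\<rbrakk> \<Longrightarrow> \<one> \<preceq> x \<otimes> y"
  using mult_mono[of \<one> x \<one> y] by simp

lemma le_mult1: "\<lbrakk>\<one> \<preceq> y; x \<in> carrier G; y \<in> carrier G\<rbrakk> \<Longrightarrow> x \<preceq> x \<otimes> y"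
  using mult_mono[of x x \<one> y] by simp

lemma le_mult2: "\<lbrakk>\<one> \<preceq> y; x \<in> carrier G; y \<in> carrier G\<rbrakk> \<Longrightarrow> x \<preceq> y \<otimes> x"
  using mult_mono[of \<one> y x x] by simp

text \<open>Translation by \<open>u\<close> is an order isomorphism with inverse translation by
  \<open>inv u\<close>, hence preserves meets.\<close>

lemma mult_meet_distrib:
  assumes "x \<in> carrier G" "y \<in> carrier G" "u \<in> carrier G"
  shows "u \<otimes> (x \<curlywedge> y) = (u \<otimes> x) \<curlywedge> (u \<otimes> y)"
proof (rule meet_eqI[symmetric])
  fix t assume t: "t \<in> carrier G" "t \<preceq> u \<otimes> x" "t \<preceq> u \<otimes> y"
  then have "inv u \<otimes> t \<preceq> x \<curlywedge> y"
    using le_inv_mult[of _ "inv u"] assms mult_le_cancel_left[of "inv u \<otimes> t" _ u]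
    by (intro meet_greatest) (auto simp: m_assoc[symmetric])
  then show "t \<preceq> u \<otimes> (x \<curlywedge> y)"
    using mult_le_cancel_left[of "inv u \<otimes> t" "x \<curlywedge> y" u] t assms by (simp add: m_assoc[symmetric])
qed (use assms in \<open>auto simp: mult_le_cancel_left\<close>)

lemma meet_mult_distrib:
  assumes "x \<in> carrier G" "y \<in> carrier G" "u \<in> carrier G"
  shows "(x \<curlywedge> y) \<otimes> u = (x \<otimes> u) \<curlywedge> (y \<otimes> u)"
proof (rule meet_eqI[symmetric])
  fix t assume t: "t \<in> carrier G" "t \<preceq> x \<otimes> u" "t \<preceq> y \<otimes> u"
  then have "t \<otimes> inv u \<preceq> x \<curlywedge> y"
    using assms by (intro meet_greatest) (auto simp: mult_inv_le)
  then show "t \<preceq> (x \<curlywedge> y) \<otimes> u" using t assms by (simp add: mult_inv_le)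
qed (use assms in \<open>auto simp: mult_le_cancel_right\<close>)

abbreviation abs_l ("\<bar>_\<bar>\<^sub>G") where "\<bar>x\<bar>\<^sub>G \<equiv> l_abs G x"

lemma abs_closed [simp, intro]: "x \<in> carrier G \<Longrightarrow> \<bar>x\<bar>\<^sub>G \<in> carrier G"
  by (simp add: l_abs_def)

lemma le_abs [simp, intro]: "x \<in> carrier G \<Longrightarrow> x \<preceq> \<bar>x\<bar>\<^sub>G"
  and inv_le_abs [simp, intro]: "x \<in> carrier G \<Longrightarrow> inv x \<preceq> \<bar>x\<bar>\<^sub>G"
  by (simp_all add: l_abs_def)

lemma abs_least: "\<lbrakk>x \<preceq> y; inv x \<preceq> y; x \<in> carrier G; y \<in> carrier G\<rbrakk> \<Longrightarrow> \<bar>x\<bar>\<^sub>G \<preceq> y"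
  by (simp add: l_abs_def join_least)

lemma abs_inv [simp]: "x \<in> carrier G \<Longrightarrow> \<bar>inv x\<bar>\<^sub>G = \<bar>x\<bar>\<^sub>G"
  by (simp add: l_abs_def join_comm)

text \<open>Put \<open>g = |x|\<close> and \<open>m = g \<and> \<one>\<close>, the meet. Multiplying
  \<open>x\<close> and \<open>inv x\<close>, both below \<open>g\<close>, gives
  \<open>\<one>\<close> below \<open>g g\<close>. Expanding \<open>m m\<close> by distributivity
  gives the meet of \<open>g g\<close>, \<open>g\<close> and \<open>m\<close>, all above
  \<open>m\<close>; cancelling \<open>m\<close> leaves \<open>\<one>\<close> below
  \<open>m\<close>.\<close>

lemma one_le_abs [simp, intro]:
  assumes x: "x \<in> carrier G"
  shows "\<one> \<preceq> \<bar>x\<bar>\<^sub>G"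
proof -
  let ?g = "\<bar>x\<bar>\<^sub>G" and ?m = "\<bar>x\<bar>\<^sub>G \<curlywedge> \<one>"
  have g: "\<one> \<preceq> ?g \<otimes> ?g" using mult_mono[of x ?g "inv x" ?g] x by simp
  have "?m \<preceq> ?m \<otimes> ?m"
    unfolding mult_meet_distrib[of ?g \<one> ?m, OF abs_closed[OF x] one_closed meet_closed[OF abs_closed[OF x] one_closed]]
      meet_mult_distrib[of ?g \<one> ?g, OF abs_closed[OF x] one_closed abs_closed[OF x]]
    using x g by (auto intro!: meet_greatest intro: le_trans[of "?m" \<one>])
  then have "\<one> \<preceq> ?m" using x mult_le_cancel_left[of \<one> ?m ?m] by simp
  then show ?thesis using x le_trans[of \<one> ?m ?g] by simp
qed

lemma abs_of_ge_one: "\<lbrakk>\<one> \<preceq> x; x \<in> carrier G\<rbrakk> \<Longrightarrow> \<bar>x\<bar>\<^sub>G = x"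
  using inv_le_iff[of \<one> x] le_trans[of "inv x" \<one> x] by (intro le_antisym abs_least) auto

lemma abs_one [simp]: "\<bar>\<one>\<bar>\<^sub>G = \<one>"
  by (simp add: abs_of_ge_one)

lemma abs_le_one_iff: "x \<in> carrier G \<Longrightarrow> \<bar>x\<bar>\<^sub>G \<preceq> \<one> \<longleftrightarrow> x = \<one>"
  using le_trans[of x "\<bar>x\<bar>\<^sub>G" \<one>] le_trans[of "inv x" "\<bar>x\<bar>\<^sub>G" \<one>] inv_le_iff[of \<one> x]
  by (auto intro: le_antisym)

text \<open>Disjointness of the positive and the negative part of \<open>d\<close>. With
  \<open>n\<close> the join of \<open>inv d\<close> and \<open>\<one>\<close>, the positive part is
  below \<open>d n\<close>. A common lower bound \<open>t\<close> then satisfies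
  \<open>inv d\<close> and \<open>\<one>\<close> below \<open>n \<otimes> inv t\<close>, so
  \<open>n\<close> is below \<open>n \<otimes> inv t\<close>, and cancelling \<open>n\<close> puts
  \<open>t\<close> below \<open>\<one>\<close>.\<close>

lemma pos_meet_neg:
  assumes d: "d \<in> carrier G"
  shows "(d \<curlyvee> \<one>) \<curlywedge> (inv d \<curlyvee> \<one>) = \<one>"
proof (rule meet_eqI)
  fix t assume t: "t \<in> carrier G" "t \<preceq> d \<curlyvee> \<one>" "t \<preceq> inv d \<curlyvee> \<one>"
  let ?n = "inv d \<curlyvee> \<one>"
  have "inv d \<preceq> ?n" "\<one> \<preceq> ?n" using d by auto
  then have "d \<curlyvee> \<one> \<preceq> d \<otimes> ?n"
    using d mult_le_cancel_left[of \<one> ?n d] mult_le_cancel_left[of "inv d" ?n d]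
    by (intro join_least) auto
  then have 1: "t \<preceq> d \<otimes> ?n" using t d by (auto intro: le_trans)
  have "inv d \<preceq> ?n \<otimes> inv t"
  proof -
    have "inv d \<otimes> t \<preceq> ?n"
      using 1 mult_le_cancel_left[of "inv d \<otimes> t" ?n d] t d by (simp add: m_assoc[symmetric])
    then show ?thesis using t d by (simp add: le_mult_inv)
  qed
  moreover have "\<one> \<preceq> ?n \<otimes> inv t" using t d by (simp add: le_mult_inv)
  ultimately have "?n \<preceq> ?n \<otimes> inv t" using t d by (intro join_least) auto
  then have "\<one> \<preceq> inv t" using mult_le_cancel_left[of \<one> "inv t" ?n] t d by simp
  then show "t \<preceq> \<one>" using inv_le_iff[of t \<one>] t by simp
qed (use d in auto)

text \<open>A common lower bound \<open>t\<close> of \<open>x\<close> and \<open>y z\<close> is also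
  below \<open>x z\<close>, hence below the meet of \<open>x\<close> and \<open>y\<close> times
  \<open>z\<close>, which is \<open>z\<close>; so it is below the meet of \<open>x\<close> and
  \<open>z\<close>.\<close>

lemma meet_mult_eq_one:
  assumes "x \<curlywedge> y = \<one>" "x \<curlywedge> z = \<one>" "x \<in> carrier G" "y \<in> carrier G" "z \<in> carrier G"
  shows "x \<curlywedge> (y \<otimes> z) = \<one>"
proof (rule meet_eqI)
  have one: "\<one> \<preceq> x" "\<one> \<preceq> y" "\<one> \<preceq> z" using assms meet_le1 meet_le2 by metis+
  show "\<one> \<preceq> x" "\<one> \<preceq> y \<otimes> z" using one assms by (auto intro: one_le_mult)
  fix t assume t: "t \<in> carrier G" "t \<preceq> x" "t \<preceq> y \<otimes> z"
  then have "t \<preceq> x \<otimes> z" using one assms le_trans[of t x "x \<otimes> z"] le_mult1 by auto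
  then have "t \<preceq> (x \<curlywedge> y) \<otimes> z" unfolding meet_mult_distrib[OF assms(3-5)]
    using t assms by (intro meet_greatest) auto
  then have "t \<preceq> z" using assms by simp
  then show "t \<preceq> \<one>" using t assms meet_greatest[of t x z] by simp
qed (use assms in auto)

lemma meet_pow_eq_one:
  assumes "x \<curlywedge> y = \<one>" "x \<in> carrier G" "y \<in> carrier G"
  shows "x \<curlywedge> y [^] (n::nat) = \<one>"
proof (induction n)
  case 0
  have "\<one> \<preceq> x" using assms meet_le1 by metis
  then show ?case using assms by (intro meet_eqI) auto
next
  case (Suc n)
  then show ?case using assms by (simp add: meet_mult_eq_one)
qed

lemma meet_pow_pow_eq_one:
  assumes "x \<curlywedge> y = \<one>" "x \<in> carrier G" "y \<in> carrier G"
  shows "x [^] (m::nat) \<curlywedge> y [^] (n::nat) = \<one>"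
  using meet_pow_eq_one[of "y [^] n" x m] meet_pow_eq_one[OF assms, of n] assms
  by (metis meet_comm nat_pow_closed)

end

subsection \<open>Convex subgroups and values\<close>

context lgroup
begin

lemma convex_l_subgroupD:
  assumes "convex_l_subgroup G H"
  shows "subgroup H G" "H \<subseteq> carrier G"
    and "\<And>x. x \<in> H \<Longrightarrow> x \<in> carrier G"
    and "\<one> \<in> H"
    and "\<And>x. x \<in> H \<Longrightarrow> inv x \<in> H"
    and "\<And>x y. x \<in> H \<Longrightarrow> y \<in> H \<Longrightarrow> x \<otimes> y \<in> H"
    and "\<And>x y. x \<in> H \<Longrightarrow> y \<in> H \<Longrightarrow> x \<curlyvee> y \<in> H"
    and "\<And>x y. x \<in> H \<Longrightarrow> y \<in> H \<Longrightarrow> x \<curlywedge> y \<in> H"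
    and "\<And>x y z. \<lbrakk>x \<in> H; y \<in> H; z \<in> carrier G; x \<preceq> z; z \<preceq> y\<rbrakk> \<Longrightarrow> z \<in> H"
    and "\<And>x (n::nat). x \<in> H \<Longrightarrow> x [^] n \<in> H"
    and "\<And>x. x \<in> H \<Longrightarrow> \<bar>x\<bar>\<^sub>G \<in> H"
proof -
  show sg: "subgroup H G" using assms by (simp add: convex_l_subgroup_def l_subgroup_def)
  show "H \<subseteq> carrier G" "\<one> \<in> H"
    by (rule subgroup.subset[OF sg], rule subgroup.one_closed[OF sg])
  then show "x \<in> carrier G" if "x \<in> H" for x using that by blast
  show inv: "inv x \<in> H" if "x \<in> H" for x
    using that by (rule subgroup.m_inv_closed[OF sg])
  show mult: "x \<otimes> y \<in> H" if "x \<in> H" "y \<in> H" for x y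
    using that by (rule subgroup.m_closed[OF sg])
  show join: "x \<curlyvee> y \<in> H" and "x \<curlywedge> y \<in> H" if "x \<in> H" "y \<in> H" for x y
    using assms that unfolding convex_l_subgroup_def l_subgroup_def by blast+
  show "\<lbrakk>x \<in> H; y \<in> H; z \<in> carrier G; x \<preceq> z; z \<preceq> y\<rbrakk> \<Longrightarrow> z \<in> H" for x y z
    using assms unfolding convex_l_subgroup_def by blast
  show "x [^] n \<in> H" if "x \<in> H" for x and n :: nat
    by (induction n) (simp_all add: \<open>\<one> \<in> H\<close> mult that)
  show "\<bar>x\<bar>\<^sub>G \<in> H" if "x \<in> H" for x
    unfolding l_abs_def by (intro join inv that)
qed

lemma convex_l_subgroupI:
  assumes "subgroup H G"
    and "\<And>x y. x \<in> H \<Longrightarrow> y \<in> H \<Longrightarrow> x \<curlyvee> y \<in> H"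
    and "\<And>x y. x \<in> H \<Longrightarrow> y \<in> H \<Longrightarrow> x \<curlywedge> y \<in> H"
    and "\<And>x y z. \<lbrakk>x \<in> H; y \<in> H; z \<in> carrier G; x \<preceq> z; z \<preceq> y\<rbrakk> \<Longrightarrow> z \<in> H"
  shows "convex_l_subgroup G H"
  unfolding convex_l_subgroup_def l_subgroup_def using assms by (intro conjI ballI impI)

lemma convex_abs_mem_iff: "\<bar>x\<bar>\<^sub>G \<in> H \<longleftrightarrow> x \<in> H"
  if H: "convex_l_subgroup G H" and x: "x \<in> carrier G"
proof
  assume "\<bar>x\<bar>\<^sub>G \<in> H"
  moreover from this have "inv \<bar>x\<bar>\<^sub>G \<in> H" using convex_l_subgroupD(5)[OF H] by blast
  moreover have "inv \<bar>x\<bar>\<^sub>G \<preceq> x" using inv_le_iff[of "inv x" "\<bar>x\<bar>\<^sub>G"] x by simp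
  ultimately show "x \<in> H" using convex_l_subgroupD(9)[OF H, of "inv \<bar>x\<bar>\<^sub>G" "\<bar>x\<bar>\<^sub>G" x] x by simp
qed (use convex_l_subgroupD(11)[OF H] in blast)

lemma convex_abs_le_mem:
  assumes "convex_l_subgroup G H" "y \<in> H" "x \<in> carrier G" "\<bar>x\<bar>\<^sub>G \<preceq> y"
  shows "x \<in> H"
proof -
  have "\<bar>x\<bar>\<^sub>G \<in> H"
    using assms convex_l_subgroupD(9)[OF assms(1), of \<one> y "\<bar>x\<bar>\<^sub>G"] convex_l_subgroupD(4)[OF assms(1)] by simp
  then show ?thesis using assms convex_abs_mem_iff by blast
qed

text \<open>The inverse of \<open>x \<otimes> y\<close> is bounded by \<open>|y| |x|\<close>, with
  the factors in the reverse order. The symmetric product on the right dominates both this and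
  \<open>|x| |y|\<close>.\<close>

lemma abs_mult_le:
  assumes "x \<in> carrier G" "y \<in> carrier G"
  shows "\<bar>x \<otimes> y\<bar>\<^sub>G \<preceq> \<bar>x\<bar>\<^sub>G \<otimes> \<bar>y\<bar>\<^sub>G \<otimes> \<bar>x\<bar>\<^sub>G"
proof (rule abs_least)
  have "x \<otimes> y \<preceq> \<bar>x\<bar>\<^sub>G \<otimes> \<bar>y\<bar>\<^sub>G" using assms by (intro mult_mono) auto
  then show "x \<otimes> y \<preceq> \<bar>x\<bar>\<^sub>G \<otimes> \<bar>y\<bar>\<^sub>G \<otimes> \<bar>x\<bar>\<^sub>G"
    using assms le_trans[OF _ le_mult1[of "\<bar>x\<bar>\<^sub>G" "\<bar>x\<bar>\<^sub>G \<otimes> \<bar>y\<bar>\<^sub>G"]] by simp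
  have "inv (x \<otimes> y) \<preceq> \<bar>y\<bar>\<^sub>G \<otimes> \<bar>x\<bar>\<^sub>G" using assms by (simp add: inv_mult_group mult_mono)
  then show "inv (x \<otimes> y) \<preceq> \<bar>x\<bar>\<^sub>G \<otimes> \<bar>y\<bar>\<^sub>G \<otimes> \<bar>x\<bar>\<^sub>G"
    using assms le_trans[OF _ le_mult2[of "\<bar>x\<bar>\<^sub>G" "\<bar>y\<bar>\<^sub>G \<otimes> \<bar>x\<bar>\<^sub>G"]] by (simp add: m_assoc)
qed (use assms in auto)

text \<open>A convex subgroup is determined by its positive cone, so it suffices to exhibit a
  submonoid that is closed downwards among the elements above \<open>\<one>\<close>. This is the
  common source of \<open>convex_principal\<close> and \<open>convex_extend\<close>.\<close>

lemma convex_l_subgroup_of_cone: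
  assumes P: "\<one> \<in> P" "\<And>x y. x \<in> P \<Longrightarrow> y \<in> P \<Longrightarrow> x \<otimes> y \<in> P"
    and down: "\<And>x y. y \<in> P \<Longrightarrow> x \<in> carrier G \<Longrightarrow> \<one> \<preceq> x \<Longrightarrow> x \<preceq> y \<Longrightarrow> x \<in> P"
  shows "convex_l_subgroup G {x \<in> carrier G. \<bar>x\<bar>\<^sub>G \<in> P}" (is "convex_l_subgroup G ?H")
proof -
  \<comment> \<open>Every lattice and convexity condition is reduced to bounding an element and its
    inverse by the product of two absolute values from \<open>P\<close>.\<close>
  have I: "z \<in> ?H" if "\<bar>x\<bar>\<^sub>G \<in> P" "\<bar>y\<bar>\<^sub>G \<in> P" "z \<in> carrier G" "x \<in> carrier G" "y \<in> carrier G"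
    "z \<preceq> \<bar>x\<bar>\<^sub>G \<otimes> \<bar>y\<bar>\<^sub>G" "inv z \<preceq> \<bar>x\<bar>\<^sub>G \<otimes> \<bar>y\<bar>\<^sub>G" for x y z
    using down[OF P(2)[OF that(1,2)], of "\<bar>z\<bar>\<^sub>G"] abs_least[of z "\<bar>x\<bar>\<^sub>G \<otimes> \<bar>y\<bar>\<^sub>G"] that by simp
  have le1: "z \<preceq> \<bar>x\<bar>\<^sub>G \<otimes> \<bar>y\<bar>\<^sub>G" if "z \<preceq> \<bar>x\<bar>\<^sub>G" "x \<in> carrier G" "y \<in> carrier G" "z \<in> carrier G" for x y z
    using that by (intro le_trans[OF that(1) le_mult1]) auto
  have le2: "z \<preceq> \<bar>x\<bar>\<^sub>G \<otimes> \<bar>y\<bar>\<^sub>G" if "z \<preceq> \<bar>y\<bar>\<^sub>G" "x \<in> carrier G" "y \<in> carrier G" "z \<in> carrier G" for x y z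
    using that by (intro le_trans[OF that(1) le_mult2]) auto
  have "subgroup ?H G"
  proof (rule subgroupI)
    show "?H \<subseteq> carrier G" "?H \<noteq> {}" using P(1) by auto
    show "x \<otimes> y \<in> ?H" if "x \<in> ?H" "y \<in> ?H" for x y
    proof -
      have "\<bar>x\<bar>\<^sub>G \<otimes> \<bar>y\<bar>\<^sub>G \<otimes> \<bar>x\<bar>\<^sub>G \<in> P" using that P by auto
      then show ?thesis using that abs_mult_le[of x y] by (auto intro: down)
    qed
  qed auto
  moreover have "x \<curlyvee> y \<in> ?H" if "x \<in> ?H" "y \<in> ?H" for x y
  proof (rule I[of x y])
    show "x \<curlyvee> y \<preceq> \<bar>x\<bar>\<^sub>G \<otimes> \<bar>y\<bar>\<^sub>G" using that by (intro join_least le1 le2) auto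
    have "inv (x \<curlyvee> y) \<preceq> inv x" using that by (simp add: inv_le_iff)
    then show "inv (x \<curlyvee> y) \<preceq> \<bar>x\<bar>\<^sub>G \<otimes> \<bar>y\<bar>\<^sub>G"
      using that by (intro le1) (rule le_trans[of _ "inv x" "\<bar>x\<bar>\<^sub>G"], auto)+
  qed (use that in auto)
  moreover have "x \<curlywedge> y \<in> ?H" if "x \<in> ?H" "y \<in> ?H" for x y
  proof (rule I[of x y])
    show "x \<curlywedge> y \<preceq> \<bar>x\<bar>\<^sub>G \<otimes> \<bar>y\<bar>\<^sub>G"
      using that by (intro le1) (rule le_trans[of _ x "\<bar>x\<bar>\<^sub>G"], auto)+
    have "inv (\<bar>x\<bar>\<^sub>G \<otimes> \<bar>y\<bar>\<^sub>G) \<preceq> x" "inv (\<bar>x\<bar>\<^sub>G \<otimes> \<bar>y\<bar>\<^sub>G) \<preceq> y"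
      using that inv_le_iff[of "inv x" "\<bar>x\<bar>\<^sub>G \<otimes> \<bar>y\<bar>\<^sub>G"] inv_le_iff[of "inv y" "\<bar>x\<bar>\<^sub>G \<otimes> \<bar>y\<bar>\<^sub>G"]
      by (simp_all add: le1 le2)
    then have "inv (\<bar>x\<bar>\<^sub>G \<otimes> \<bar>y\<bar>\<^sub>G) \<preceq> x \<curlywedge> y"
      using that by (intro meet_greatest) auto
    then show "inv (x \<curlywedge> y) \<preceq> \<bar>x\<bar>\<^sub>G \<otimes> \<bar>y\<bar>\<^sub>G"
      using that inv_le_iff[of "inv (\<bar>x\<bar>\<^sub>G \<otimes> \<bar>y\<bar>\<^sub>G)" "x \<curlywedge> y"] by simp
  qed (use that in auto)
  moreover have "z \<in> ?H" if "x \<in> ?H" "y \<in> ?H" "z \<in> carrier G" "x \<preceq> z" "z \<preceq> y" for x y z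
  proof (rule I[of x y])
    show "z \<preceq> \<bar>x\<bar>\<^sub>G \<otimes> \<bar>y\<bar>\<^sub>G" using that by (intro le2) (rule le_trans[of _ y "\<bar>y\<bar>\<^sub>G"], auto)+
    have "inv z \<preceq> inv x" using that by (simp add: inv_le_iff)
    then show "inv z \<preceq> \<bar>x\<bar>\<^sub>G \<otimes> \<bar>y\<bar>\<^sub>G" using that by (intro le1) (rule le_trans[of _ "inv x" "\<bar>x\<bar>\<^sub>G"], auto)+
  qed (use that in auto)
  ultimately show ?thesis by (rule convex_l_subgroupI)
qed

lemma convex_carrier: "convex_l_subgroup G (carrier G)"
  by (auto simp: convex_l_subgroup_def l_subgroup_def subgroup_self)

lemma convex_principal:
  assumes a: "a \<in> carrier G"
  shows "convex_l_subgroup G (principal_l G a)"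
proof -
  define P where "P = {x \<in> carrier G. \<one> \<preceq> x \<and> (\<exists>n::nat. x \<preceq> \<bar>a\<bar>\<^sub>G [^] n)}"
  have "convex_l_subgroup G {x \<in> carrier G. \<bar>x\<bar>\<^sub>G \<in> P}"
  proof (rule convex_l_subgroup_of_cone)
    show "\<one> \<in> P" unfolding P_def by (auto intro!: exI[of _ 0])
    show "x \<otimes> y \<in> P" if xy: "x \<in> P" "y \<in> P" for x y
    proof -
      obtain m n :: nat where mn: "x \<preceq> \<bar>a\<bar>\<^sub>G [^] m" "y \<preceq> \<bar>a\<bar>\<^sub>G [^] n" using xy by (auto simp: P_def)
      then have "x \<otimes> y \<preceq> \<bar>a\<bar>\<^sub>G [^] (m + n)"
        using xy a mult_mono[OF mn] by (simp add: P_def nat_pow_mult)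
      then show ?thesis using xy by (auto simp: P_def one_le_mult)
    qed
    show "x \<in> P" if "y \<in> P" "x \<in> carrier G" "\<one> \<preceq> x" "x \<preceq> y" for x y
      using that a by (auto simp: P_def intro: le_trans[of x y])
  qed
  moreover have "{x \<in> carrier G. \<bar>x\<bar>\<^sub>G \<in> P} = principal_l G a" by (auto simp: P_def principal_l_def)
  ultimately show ?thesis by simp
qed

lemma mem_principal: "a \<in> carrier G \<Longrightarrow> a \<in> principal_l G a"
  unfolding principal_l_def by (auto intro!: exI[of _ 1])

lemma principal_subset_iff: "principal_l G a \<subseteq> H \<longleftrightarrow> a \<in> H"
  if H: "convex_l_subgroup G H" and a: "a \<in> carrier G"
proof
  show "principal_l G a \<subseteq> H" if "a \<in> H"
    using convex_l_subgroupD(10)[OF H convex_l_subgroupD(11)[OF H that]] convex_abs_le_mem[OF H]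
    by (auto simp: principal_l_def)
qed (use mem_principal a in blast)

lemma principal_one: "principal_l G \<one> = {\<one>}"
  by (auto simp: principal_l_def abs_le_one_iff)

lemma convex_Union_chain:
  assumes "C \<noteq> {}" "\<And>H. H \<in> C \<Longrightarrow> convex_l_subgroup G H"
    and chain: "\<And>H K. H \<in> C \<Longrightarrow> K \<in> C \<Longrightarrow> H \<subseteq> K \<or> K \<subseteq> H"
  shows "convex_l_subgroup G (\<Union>C)"
proof -
  have two: "\<exists>H\<in>C. x \<in> H \<and> y \<in> H" if "x \<in> \<Union>C" "y \<in> \<Union>C" for x y
    using that chain by blast
  note D = convex_l_subgroupD[OF assms(2)]
  have "subgroup (\<Union>C) G"
  proof (rule subgroupI)
    show "\<Union>C \<subseteq> carrier G" using D(2) by blast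
    show "\<Union>C \<noteq> {}" using assms(1) D(4) by blast
    show "\<And>a. a \<in> \<Union>C \<Longrightarrow> inv a \<in> \<Union>C" using D(5) by blast
    show "a \<otimes> b \<in> \<Union>C" if "a \<in> \<Union>C" "b \<in> \<Union>C" for a b using two[OF that] D(6) by blast
  qed
  moreover have "x \<curlyvee> y \<in> \<Union>C" "x \<curlywedge> y \<in> \<Union>C" if "x \<in> \<Union>C" "y \<in> \<Union>C" for x y
    using two[OF that] D(7,8) by blast+
  moreover have "z \<in> \<Union>C" if "x \<in> \<Union>C" "y \<in> \<Union>C" "z \<in> carrier G" "x \<preceq> z" "z \<preceq> y" for x y z
    using two[OF that(1,2)] D(9) that by blast
  ultimately show ?thesis by (rule convex_l_subgroupI)
qed

definition is_value :: "'a \<Rightarrow> 'a set \<Rightarrow> bool" where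
  "is_value a p \<longleftrightarrow> convex_l_subgroup G p \<and> a \<notin> p \<and>
     (\<forall>H. convex_l_subgroup G H \<longrightarrow> p \<subseteq> H \<longrightarrow> a \<notin> H \<longrightarrow> H = p)"

lemma ex_value:
  assumes "convex_l_subgroup G H" "a \<notin> H"
  obtains p where "is_value a p" "H \<subseteq> p"
proof -
  let ?A = "{K. convex_l_subgroup G K \<and> H \<subseteq> K \<and> a \<notin> K}"
  have "\<exists>M\<in>?A. \<forall>X\<in>?A. M \<subseteq> X \<longrightarrow> X = M"
  proof (rule subset_Zorn_nonempty)
    show "?A \<noteq> {}" using assms by blast
    fix C assume C: "C \<noteq> {}" "subset.chain ?A C"
    then have "convex_l_subgroup G (\<Union>C)"
      by (intro convex_Union_chain) (auto simp: subset.chain_def)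
    moreover have "C \<subseteq> ?A" using C by (simp add: subset.chain_def)
    then have "H \<subseteq> \<Union>C" "a \<notin> \<Union>C" using C(1) by blast+
    ultimately show "\<Union>C \<in> ?A" by blast
  qed
  then obtain p where "p \<in> ?A" and max: "\<forall>K\<in>?A. p \<subseteq> K \<longrightarrow> K = p" by (rule bexE)
  then have p: "convex_l_subgroup G p" "H \<subseteq> p" "a \<notin> p" by simp_all
  have "is_value a p" unfolding is_value_def
  proof (intro conjI allI impI)
    show "K = p" if "convex_l_subgroup G K" "p \<subseteq> K" "a \<notin> K" for K
      using bspec[OF max, of K] that p(2) by auto
  qed (use p in auto)
  then show thesis using that p(2) by blast
qed

text \<open>A convex subgroup that misses \<open>a\<close> is proper, so maximality among proper
  subgroups is stronger. Facts about values thus apply to a maximal \<open>m\<close> with any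
  element outside it.\<close>

lemma Max_l_is_value: "m \<in> Max_l G \<Longrightarrow> a \<in> carrier G \<Longrightarrow> a \<notin> m \<Longrightarrow> is_value a m"
  unfolding Max_l_def is_value_def by blast

end

subsection \<open>Groups whose convex subgroups are normal\<close>

text \<open>Hamiltonian is the established name for \<open>\<ell>\<close>-groups in which every
  convex \<open>\<ell>\<close>-subgroup is normal. The principal ones are enough: a conjugate of
  \<open>h\<close> stays in the subgroup generated by \<open>h\<close>, hence in every convex
  subgroup containing \<open>h\<close>.\<close>

locale hamiltonian_lgroup = lgroup +
  assumes normal_principal: "a \<in> carrier G \<Longrightarrow> principal_l G a \<lhd> G"
begin

lemma convex_conj_mem:
  assumes H: "convex_l_subgroup G H" and h: "h \<in> H" and g: "g \<in> carrier G"
  shows "g \<otimes> h \<otimes> inv g \<in> H"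
proof -
  have hc: "h \<in> carrier G" using convex_l_subgroupD(3)[OF H] h .
  then have "g \<otimes> h \<otimes> inv g \<in> principal_l G h"
    using normal.inv_op_closed2[OF normal_principal] g mem_principal by blast
  then show ?thesis using principal_subset_iff[OF H hc] h by blast
qed

text \<open>The convex subgroup generated by \<open>N\<close> and \<open>x\<close>, when
  \<open>N\<close> is a convex subgroup. Normality is what allows a single factor from
  \<open>N\<close> in front of a power of \<open>|x|\<close>.\<close>

definition extend :: "'a set \<Rightarrow> 'a \<Rightarrow> 'a set" where
  "extend N x = {b \<in> carrier G. \<exists>h\<in>N. \<exists>n::nat. \<bar>b\<bar>\<^sub>G \<preceq> h \<otimes> \<bar>x\<bar>\<^sub>G [^] n}"

lemma convex_extend:
  assumes N: "convex_l_subgroup G N" and x: "x \<in> carrier G"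
  shows "convex_l_subgroup G (extend N x)"
proof -
  note D = convex_l_subgroupD[OF N]
  let ?x = "\<bar>x\<bar>\<^sub>G"
  define P where "P = {p \<in> carrier G. \<one> \<preceq> p \<and> (\<exists>h\<in>N. \<exists>n::nat. p \<preceq> h \<otimes> ?x [^] n)}"
  have "convex_l_subgroup G {b \<in> carrier G. \<bar>b\<bar>\<^sub>G \<in> P}"
  proof (rule convex_l_subgroup_of_cone)
    show "\<one> \<in> P" unfolding P_def using D(4) by (auto intro!: bexI[of _ \<one>] exI[of _ 0])
    show "p \<otimes> q \<in> P" if pq: "p \<in> P" "q \<in> P" for p q
    proof -
      obtain h k and n m :: nat where h: "h \<in> N" "p \<preceq> h \<otimes> ?x [^] n"
        and k: "k \<in> N" "q \<preceq> k \<otimes> ?x [^] m" using pq by (auto simp: P_def)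
      have c: "h \<in> carrier G" "k \<in> carrier G" "p \<in> carrier G" "q \<in> carrier G"
        using h k D(3) pq by (auto simp: P_def)
      \<comment> \<open>Conjugating \<open>k\<close> by the power of \<open>|x|\<close> that stands
        before it collects both factors from \<open>N\<close> on the left and both powers on the
        right.\<close>
      let ?k = "?x [^] n \<otimes> k \<otimes> inv (?x [^] n)"
      have "p \<otimes> q \<preceq> (h \<otimes> ?x [^] n) \<otimes> (k \<otimes> ?x [^] m)"
        using h k c x by (intro mult_mono) auto
      also have "(h \<otimes> ?x [^] n) \<otimes> (k \<otimes> ?x [^] m) = (h \<otimes> ?k) \<otimes> ?x [^] (n + m)"
        using c x by (simp add: m_assoc nat_pow_mult[symmetric])
          (simp add: m_assoc[symmetric])
      finally have "p \<otimes> q \<preceq> (h \<otimes> ?k) \<otimes> ?x [^] (n + m)" .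
      moreover have "h \<otimes> ?k \<in> N" using D(6) h k x convex_conj_mem[OF N] by simp
      ultimately show ?thesis using pq by (auto simp: P_def one_le_mult)
    qed
    show "p \<in> P" if q: "q \<in> P" and p: "p \<in> carrier G" "\<one> \<preceq> p" "p \<preceq> q" for p q
    proof -
      obtain h and n :: nat where h: "h \<in> N" "q \<preceq> h \<otimes> ?x [^] n" "q \<in> carrier G"
        using q by (auto simp: P_def)
      then have "p \<preceq> h \<otimes> ?x [^] n" using p x D(3) by (intro le_trans[OF p(3) h(2)]) auto
      then show ?thesis using p h by (auto simp: P_def)
    qed
  qed
  moreover have "{b \<in> carrier G. \<bar>b\<bar>\<^sub>G \<in> P} = extend N x" by (auto simp: P_def extend_def)
  ultimately show ?thesis by simp
qed

lemma subset_extend: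
  assumes N: "convex_l_subgroup G N" and x: "x \<in> carrier G"
  shows "N \<subseteq> extend N x" "x \<in> extend N x"
proof -
  note D = convex_l_subgroupD[OF N]
  show "N \<subseteq> extend N x"
  proof
    fix h assume "h \<in> N"
    then show "h \<in> extend N x" unfolding extend_def
      using D(3) D(3)[OF D(11)] by (auto intro!: bexI[of _ "\<bar>h\<bar>\<^sub>G"] exI[of _ 0] D(11))
  qed
  show "x \<in> extend N x" unfolding extend_def
    using D(4) x by (auto intro!: bexI[of _ \<one>] exI[of _ 1])
qed

text \<open>\<open>extend p x\<close> is a convex subgroup strictly above \<open>p\<close>, so by
  maximality it cannot miss \<open>a\<close>.\<close>

lemma value_abs_le:
  assumes p: "is_value a p" and a: "a \<in> carrier G" and x: "x \<in> carrier G" "x \<notin> p"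
  obtains h and n :: nat where "h \<in> p" "\<bar>a\<bar>\<^sub>G \<preceq> h \<otimes> \<bar>x\<bar>\<^sub>G [^] n"
proof -
  have c: "convex_l_subgroup G p" using p by (simp add: is_value_def)
  have "a \<in> extend p x"
    using p convex_extend[OF c x(1)] subset_extend[OF c x(1)] x unfolding is_value_def by metis
  then show thesis using that by (auto simp: extend_def)
qed

text \<open>If disjoint \<open>x\<close> and \<open>y\<close> both lay outside \<open>p\<close>,
  then \<open>|a|\<close> would be bounded by \<open>h x^n\<close> and by \<open>k y^m\<close>.
  Replacing \<open>h\<close> and \<open>k\<close> by their join \<open>l\<close> in \<open>p\<close>
  and pulling it out of the meet leaves \<open>l\<close> as a bound, since powers of disjoint
  elements are disjoint; so \<open>a\<close> would be in \<open>p\<close>.\<close>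

lemma value_in_Spec:
  assumes p: "is_value a p" and a: "a \<in> carrier G"
  shows "p \<in> Spec_l G"
proof -
  have c: "convex_l_subgroup G p" "a \<notin> p" using p by (auto simp: is_value_def)
  note D = convex_l_subgroupD[OF c(1)]
  have "x \<in> p \<or> y \<in> p" if xy: "x \<in> carrier G" "y \<in> carrier G" "x \<curlywedge> y = \<one>" for x y
  proof (rule ccontr)
    assume "\<not> (x \<in> p \<or> y \<in> p)"
    have "\<bar>x\<bar>\<^sub>G = x" "\<bar>y\<bar>\<^sub>G = y" using xy meet_le1[of x y] meet_le2[of x y] by (simp_all add: abs_of_ge_one)
    then obtain h k and n m :: nat where h: "h \<in> p" "\<bar>a\<bar>\<^sub>G \<preceq> h \<otimes> x [^] n"
      and k: "k \<in> p" "\<bar>a\<bar>\<^sub>G \<preceq> k \<otimes> y [^] m"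
      using value_abs_le[OF p a, of x] value_abs_le[OF p a, of y] xy \<open>\<not> (x \<in> p \<or> y \<in> p)\<close> by metis
    let ?l = "h \<curlyvee> k"
    have l: "?l \<in> p" using D(7) h k by blast
    have cc: "h \<in> carrier G" "k \<in> carrier G" using D(3) h k by auto
    have "h \<otimes> x [^] n \<preceq> ?l \<otimes> x [^] n" "k \<otimes> y [^] m \<preceq> ?l \<otimes> y [^] m"
      using cc xy by (simp_all add: mult_mono)
    then have "\<bar>a\<bar>\<^sub>G \<preceq> (?l \<otimes> x [^] n) \<curlywedge> (?l \<otimes> y [^] m)"
      using h k cc xy a by (intro meet_greatest) (auto intro: le_trans[OF h(2)] le_trans[OF k(2)])
    also have "\<dots> = ?l \<otimes> (x [^] n \<curlywedge> y [^] m)" using cc xy by (simp add: mult_meet_distrib)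
    also have "\<dots> = ?l" using xy cc by (simp add: meet_pow_pow_eq_one)
    finally have "a \<in> p" using convex_abs_le_mem[OF c(1) l a] by simp
    then show False using c by simp
  qed
  then show ?thesis using c a unfolding Spec_l_def by blast
qed

lemma Max_subset_Spec: "Max_l G \<subseteq> Spec_l G"
proof
  fix m assume m: "m \<in> Max_l G"
  then have "convex_l_subgroup G m" "m \<noteq> carrier G" by (auto simp: Max_l_def)
  then obtain a where "a \<in> carrier G" "a \<notin> m" using convex_l_subgroupD(2) by blast
  then show "m \<in> Spec_l G" using Max_l_is_value[OF m] value_in_Spec by blast
qed

lemma ex_prime_separating:
  assumes "a \<in> carrier G" "b \<in> carrier G" "a \<notin> principal_l G b"
  obtains p where "p \<in> Spec_l G" "b \<in> p" "a \<notin> p"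
proof -
  obtain p where p: "is_value a p" "principal_l G b \<subseteq> p"
    using ex_value[OF convex_principal[OF assms(2)] assms(3)] .
  then show thesis
    using that[of p] value_in_Spec[OF p(1) assms(1)] mem_principal[OF assms(2)]
    unfolding is_value_def by blast
qed

text \<open>The order of the quotient by \<open>m\<close>, pulled back to representatives.\<close>

definition le_mod :: "'a set \<Rightarrow> 'a \<Rightarrow> 'a \<Rightarrow> bool" where
  "le_mod m x y \<longleftrightarrow> (\<exists>h\<in>m. x \<preceq> h \<otimes> y)"

lemma le_mod_mult_cancel:
  assumes m: "convex_l_subgroup G m" and "le_mod m x y" "x \<in> carrier G" "y \<in> carrier G" "u \<in> carrier G" "v \<in> carrier G"
  shows "le_mod m (u \<otimes> x \<otimes> v) (u \<otimes> y \<otimes> v)"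
proof -
  obtain h where h: "h \<in> m" "x \<preceq> h \<otimes> y" using assms by (auto simp: le_mod_def)
  have hc: "h \<in> carrier G" using h convex_l_subgroupD(3)[OF m] by blast
  have "u \<otimes> x \<otimes> v \<preceq> u \<otimes> (h \<otimes> y) \<otimes> v" using h hc assms by (intro lle_translate) auto
  also have "u \<otimes> (h \<otimes> y) \<otimes> v = (u \<otimes> h \<otimes> inv u) \<otimes> (u \<otimes> y \<otimes> v)"
    using hc assms by (simp add: m_assoc) (simp add: m_assoc[symmetric])
  finally show ?thesis
    using convex_conj_mem[OF m h(1), of u] assms unfolding le_mod_def by blast
qed

lemma le_mod_trans:
  assumes m: "convex_l_subgroup G m" and "le_mod m x y" "le_mod m y z"
    and c: "x \<in> carrier G" "y \<in> carrier G" "z \<in> carrier G"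
  shows "le_mod m x z"
proof -
  note D = convex_l_subgroupD[OF m]
  obtain h k where h: "h \<in> m" "x \<preceq> h \<otimes> y" and k: "k \<in> m" "y \<preceq> k \<otimes> z"
    using assms by (auto simp: le_mod_def)
  have hc: "h \<in> carrier G" "k \<in> carrier G" using h k D(3) by auto
  then have "x \<preceq> (h \<otimes> k) \<otimes> z"
    using le_trans[OF h(2), of "h \<otimes> (k \<otimes> z)"] k c by (simp add: m_assoc mult_le_cancel_left)
  then show ?thesis using D(6) h k unfolding le_mod_def by blast
qed

lemma le_mod_of_le: "convex_l_subgroup G m \<Longrightarrow> x \<preceq> y \<Longrightarrow> y \<in> carrier G \<Longrightarrow> le_mod m x y"
  unfolding le_mod_def using convex_l_subgroupD(4) by force

text \<open>The positive and negative parts of \<open>x \<otimes> inv y\<close> are disjoint, and a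
  prime subgroup contains one of them. That part serves as the factor \<open>h\<close> in
  \<open>le_mod\<close>.\<close>

lemma le_mod_total:
  assumes m: "m \<in> Spec_l G" and c: "x \<in> carrier G" "y \<in> carrier G"
  shows "le_mod m x y \<or> le_mod m y x"
proof -
  let ?d = "x \<otimes> inv y"
  have "?d \<curlyvee> \<one> \<in> m \<or> inv ?d \<curlyvee> \<one> \<in> m"
    using m pos_meet_neg[of ?d] c unfolding Spec_l_def by simp
  moreover have "x \<preceq> (?d \<curlyvee> \<one>) \<otimes> y" using c mult_inv_le[of x y "?d \<curlyvee> \<one>"] by simp
  moreover have "y \<preceq> (inv ?d \<curlyvee> \<one>) \<otimes> x"
    using c mult_inv_le[of y x "inv ?d \<curlyvee> \<one>"] join_ge1[of "inv ?d" \<one>] by (simp add: inv_mult_group)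
  ultimately show ?thesis unfolding le_mod_def by blast
qed

lemma le_mod_one_iff:
  assumes m: "convex_l_subgroup G m" and x: "x \<in> carrier G"
  shows "le_mod m x \<one> \<and> le_mod m \<one> x \<longleftrightarrow> x \<in> m"
proof
  note D = convex_l_subgroupD[OF m]
  assume "le_mod m x \<one> \<and> le_mod m \<one> x"
  then obtain h k where h: "h \<in> m" "x \<preceq> h" and k: "k \<in> m" "\<one> \<preceq> k \<otimes> x"
    using D(3) by (auto simp: le_mod_def)
  have "inv k \<preceq> x" using k x D(3) mult_le_cancel_left[of "inv k" x k] by simp
  then show "x \<in> m" using D(9)[of "inv k" h x] D(5) h k x by blast
next
  note D = convex_l_subgroupD[OF m]
  assume "x \<in> m"
  then show "le_mod m x \<one> \<and> le_mod m \<one> x" unfolding le_mod_def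
    using D(5) x by (intro conjI bexI[of _ x] bexI[of _ "inv x"]) simp_all
qed

text \<open>For \<open>b\<close> outside \<open>m\<close>, the subgroup \<open>m\<close> is a value
  of \<open>b\<close>, and the bound in \<open>value_abs_le\<close> is an archimedean inequality
  modulo \<open>m\<close>.\<close>

lemma Max_archimedean:
  assumes m: "m \<in> Max_l G"
  shows "archimedean_preordered_group G (le_mod m)"
proof
  have c: "convex_l_subgroup G m" using m by (simp add: Max_l_def)
  have s: "m \<in> Spec_l G" using m Max_subset_Spec by blast
  note D = convex_l_subgroupD[OF c]
  show total: "le_mod m x y \<or> le_mod m y x" if "x \<in> carrier G" "y \<in> carrier G" for x y
    using le_mod_total[OF s that] .
  show "le_mod m x z" if "le_mod m x y" "le_mod m y z" "x \<in> carrier G" "y \<in> carrier G" "z \<in> carrier G" for x y z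
    using le_mod_trans[OF c that] .
  show "le_mod m (u \<otimes> x \<otimes> v) (u \<otimes> y \<otimes> v)"
    if "le_mod m x y" "x \<in> carrier G" "y \<in> carrier G" "u \<in> carrier G" "v \<in> carrier G" for x y u v
    using le_mod_mult_cancel[OF c that] .
  fix u b assume ub: "u \<in> carrier G" "b \<in> carrier G" "\<not> le_mod m u \<one>"
  have "le_mod m \<one> u" using total[of u \<one>] ub by simp
  then obtain k where k: "k \<in> m" "\<one> \<preceq> k \<otimes> u" by (auto simp: le_mod_def)
  \<comment> \<open>The element \<open>u\<close> is above \<open>\<one>\<close> only modulo
    \<open>m\<close>. The congruent element \<open>?k\<close> is above \<open>\<one>\<close> in
    \<open>G\<close>, so it equals its own absolute value and \<open>value_abs_le\<close> speaks
    about its powers.\<close>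
  let ?k = "k \<otimes> u"
  have kc: "k \<in> carrier G" using k D(3) by blast
  have "?k \<notin> m"
  proof
    assume "?k \<in> m"
    then have "inv k \<otimes> ?k \<in> m" using D(5,6) k by blast
    then have "u \<in> m" using kc ub by (simp add: m_assoc[symmetric])
    then show False using ub le_mod_one_iff[OF c] by blast
  qed
  show "\<exists>n::nat. le_mod m b (u [^] n)"
  proof (cases "b \<in> m")
    case True
    then show ?thesis using le_mod_one_iff[OF c ub(2)] by (intro exI[of _ 0]) simp
  next
    case False
    then obtain h and n :: nat where h: "h \<in> m" "\<bar>b\<bar>\<^sub>G \<preceq> h \<otimes> \<bar>?k\<bar>\<^sub>G [^] n"
      using value_abs_le[OF Max_l_is_value[OF m ub(2)] ub(2), of ?k] kc ub \<open>?k \<notin> m\<close> by auto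
    then have "b \<preceq> h \<otimes> ?k [^] n"
      using le_trans[OF le_abs[OF ub(2)] h(2)] abs_of_ge_one[of ?k] k kc ub D(3) by simp
    then have "le_mod m b (?k [^] n)" using h by (auto simp: le_mod_def)
    \<comment> \<open>Back from the representative \<open>?k\<close> to \<open>u\<close>, one factor
      at a time.\<close>
    moreover have "le_mod m (?k [^] n) (u [^] n)"
    proof (induction n)
      case 0
      then show ?case using le_mod_of_le[OF c] by simp
    next
      case (Suc n)
      have "le_mod m ?k u" unfolding le_mod_def using k kc ub by blast
      then have "le_mod m (?k [^] n \<otimes> ?k) (?k [^] n \<otimes> u)"
        using le_mod_mult_cancel[OF c, of ?k u "?k [^] n" \<one>] kc ub by simp
      moreover have "le_mod m (?k [^] n \<otimes> u) (u [^] n \<otimes> u)"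
        using le_mod_mult_cancel[OF c Suc, of \<one> u] kc ub by simp
      ultimately show ?case using le_mod_trans[OF c] kc ub by simp
    qed
    ultimately show ?thesis using le_mod_trans[OF c] kc ub by blast
  qed
qed

text \<open>Since \<open>\<phi>\<close> both preserves and reflects \<open>le_mod m\<close>, its
  kernel consists of the elements congruent to \<open>\<one>\<close>, which is
  \<open>m\<close>.\<close>

lemma Max_real_hom:
  assumes m: "m \<in> Max_l G"
  obtains \<phi> :: "'a \<Rightarrow> real" where
    "\<And>x y. x \<in> carrier G \<Longrightarrow> y \<in> carrier G \<Longrightarrow> \<phi> (x \<otimes> y) = \<phi> x + \<phi> y"
    "\<And>x y. x \<in> carrier G \<Longrightarrow> y \<in> carrier G \<Longrightarrow> \<phi> (x \<curlyvee> y) = max (\<phi> x) (\<phi> y)"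
    "\<And>x y. x \<in> carrier G \<Longrightarrow> y \<in> carrier G \<Longrightarrow> \<phi> (x \<curlywedge> y) = min (\<phi> x) (\<phi> y)"
    "\<And>x. x \<in> carrier G \<Longrightarrow> \<phi> x = 0 \<longleftrightarrow> x \<in> m"
proof -
  have c: "convex_l_subgroup G m" using m by (simp add: Max_l_def)
  note D = convex_l_subgroupD[OF c]
  interpret A: archimedean_preordered_group G "le_mod m" using Max_archimedean[OF m] .
  obtain \<phi> :: "'a \<Rightarrow> real" where
    add: "\<And>x y. x \<in> carrier G \<Longrightarrow> y \<in> carrier G \<Longrightarrow> \<phi> (x \<otimes> y) = \<phi> x + \<phi> y"
    and le: "\<And>x y. x \<in> carrier G \<Longrightarrow> y \<in> carrier G \<Longrightarrow> le_mod m x y \<longleftrightarrow> \<phi> x \<le> \<phi> y"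
    using A.ex_real_hom by blast
  have mono: "\<phi> x \<le> \<phi> y" if "x \<preceq> y" "x \<in> carrier G" "y \<in> carrier G" for x y
    using le_mod_of_le[OF c] le that by blast
  have join1: "\<phi> (x \<curlyvee> y) = max (\<phi> x) (\<phi> y) \<and> \<phi> (x \<curlywedge> y) = min (\<phi> x) (\<phi> y)"
    if xy: "x \<in> carrier G" "y \<in> carrier G" and le_xy: "\<phi> x \<le> \<phi> y" for x y
  proof -
    obtain h where h: "h \<in> m" "x \<preceq> h \<otimes> y" using le[OF xy] le_xy by (auto simp: le_mod_def)
    \<comment> \<open>Unlike \<open>h\<close>, its absolute value is above \<open>\<one>\<close>, so
      \<open>?h \<otimes> y\<close> bounds both \<open>x\<close> and \<open>y\<close>, and dually
      \<open>inv ?h \<otimes> x\<close> is below both. Elements of \<open>m\<close> do not change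
      \<open>\<phi>\<close>, so the join has at most the value of \<open>y\<close> and the meet at
      least that of \<open>x\<close>.\<close>
    let ?h = "\<bar>h\<bar>\<^sub>G"
    have hc: "h \<in> carrier G" and hm: "?h \<in> m" "inv ?h \<in> m" using h D(3,5,11) by auto
    have "h \<otimes> y \<preceq> ?h \<otimes> y" using hc xy by (simp add: mult_le_cancel_right)
    then have x: "x \<preceq> ?h \<otimes> y" using le_trans[OF h(2)] hc xy by simp
    moreover have "y \<preceq> ?h \<otimes> y" using hc xy by (simp add: le_mult2)
    ultimately have "x \<curlyvee> y \<preceq> ?h \<otimes> y" using hc xy by (intro join_least) auto
    then have "\<phi> (x \<curlyvee> y) \<le> \<phi> y" using le xy hm unfolding le_mod_def by blast
    moreover have "inv ?h \<otimes> x \<preceq> x \<curlywedge> y"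
    proof (rule meet_greatest)
      show "inv ?h \<otimes> x \<preceq> y"
        using x hc xy mult_le_cancel_left[of "inv ?h \<otimes> x" y ?h] by (simp add: m_assoc[symmetric])
      show "inv ?h \<otimes> x \<preceq> x"
        using hc xy mult_le_cancel_left[of "inv ?h \<otimes> x" x ?h] by (simp add: m_assoc[symmetric] le_mult2)
    qed (use hc xy in auto)
    then have "x \<preceq> ?h \<otimes> (x \<curlywedge> y)"
      using hc xy mult_le_cancel_left[of "inv ?h \<otimes> x" "x \<curlywedge> y" ?h] by (simp add: m_assoc[symmetric])
    then have "\<phi> x \<le> \<phi> (x \<curlywedge> y)" using le xy hm unfolding le_mod_def by blast
    ultimately show ?thesis using mono[of y "x \<curlyvee> y"] mono[of "x \<curlywedge> y" x] that by simp
  qed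
  have lattice: "\<phi> (x \<curlyvee> y) = max (\<phi> x) (\<phi> y) \<and> \<phi> (x \<curlywedge> y) = min (\<phi> x) (\<phi> y)"
    if "x \<in> carrier G" "y \<in> carrier G" for x y
    using join1[of x y] join1[of y x] that by (metis join_comm meet_comm linear max.commute min.commute)
  have one: "\<phi> \<one> = 0" using add[of \<one> \<one>] by simp
  have "\<phi> x = 0 \<longleftrightarrow> x \<in> m" if "x \<in> carrier G" for x
    using le_mod_one_iff[OF c that] le[of x \<one>] le[of \<one> x] that one by auto
  then show thesis using that[of \<phi>] add lattice by blast
qed

end

subsection \<open>Representations by real functions\<close>

context lgroup
begin

text \<open>The pivot for all equivalences. Any family of maximal subgroups with intersection
  \<open>G(a)\<close> lies within the family of all those containing \<open>a\<close>, and the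
  intersection of the latter still contains \<open>G(a)\<close>; so only this largest family has to
  be tested.\<close>

lemma yosida_iff:
  "yosida G \<longleftrightarrow> (\<forall>a\<in>carrier G. \<forall>b\<in>carrier G.
     (\<forall>m\<in>Max_l G. a \<in> m \<longrightarrow> b \<in> m) \<longrightarrow> b \<in> principal_l G a)"
proof
  assume Y: "yosida G"
  show "\<forall>a\<in>carrier G. \<forall>b\<in>carrier G.
     (\<forall>m\<in>Max_l G. a \<in> m \<longrightarrow> b \<in> m) \<longrightarrow> b \<in> principal_l G a"
  proof (intro ballI impI)
    fix a b assume ab: "a \<in> carrier G" "b \<in> carrier G" "\<forall>m\<in>Max_l G. a \<in> m \<longrightarrow> b \<in> m"
    obtain M where M: "M \<subseteq> Max_l G" "principal_l G a = Inter_l G M"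
      using Y ab unfolding yosida_def by blast
    have "a \<in> Inter_l G M" using mem_principal[OF ab(1)] M(2) by simp
    then show "b \<in> principal_l G a" unfolding M(2) using ab M(1) by (auto simp: Inter_l_def)
  qed
next
  assume *: "\<forall>a\<in>carrier G. \<forall>b\<in>carrier G.
     (\<forall>m\<in>Max_l G. a \<in> m \<longrightarrow> b \<in> m) \<longrightarrow> b \<in> principal_l G a"
  show "yosida G" unfolding yosida_def
  proof (intro ballI exI conjI)
    fix a assume a: "a \<in> carrier G"
    let ?M = "{m \<in> Max_l G. a \<in> m}"
    show "?M \<subseteq> Max_l G" by blast
    have "principal_l G a \<subseteq> m" if "m \<in> ?M" for m
      using that principal_subset_iff[OF _ a, of m] by (simp add: Max_l_def)
    moreover have "principal_l G a \<subseteq> carrier G" by (auto simp: principal_l_def)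
    moreover have "b \<in> principal_l G a" if "b \<in> Inter_l G ?M" for b
      using *[rule_format, OF a, of b] that by (simp add: Inter_l_def)
    ultimately show "principal_l G a = Inter_l G ?M" by (auto simp: Inter_l_def)
  qed
qed

lemma yosida_Inter_Max:
  assumes "yosida G"
  shows "Inter_l G (Max_l G) = {\<one>}"
proof -
  have "b = \<one>" if "b \<in> Inter_l G (Max_l G)" for b
    using assms[unfolded yosida_iff, rule_format, of \<one> b] that by (simp add: Inter_l_def principal_one)
  moreover have "\<one> \<in> Inter_l G (Max_l G)"
    using convex_l_subgroupD(4) by (auto simp: Inter_l_def Max_l_def)
  ultimately show ?thesis by blast
qed

text \<open>Forwards all of \<open>Max_l G\<close> serves as the family. Backwards, an implication
  between memberships that holds throughout \<open>Max_l G\<close> holds in particular on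
  \<open>M\<close>, where the hull condition applies.\<close>

lemma yosida_iff_zeros_max:
  "yosida G \<longleftrightarrow> (\<exists>M \<subseteq> Max_l G. Inter_l G M = {\<one>} \<and>
     (\<forall>a\<in>carrier G. principal_l G a = zero_hull G (zeros_max M) a))"
proof
  assume Y: "yosida G"
  have "principal_l G a = zero_hull G (zeros_max (Max_l G)) a" if a: "a \<in> carrier G" for a
  proof (intro equalityI subsetI)
    fix b assume b: "b \<in> principal_l G a"
    have "principal_l G a \<subseteq> m" if "m \<in> Max_l G" "a \<in> m" for m
      using that principal_subset_iff[OF _ a, of m] by (simp add: Max_l_def)
    then show "b \<in> zero_hull G (zeros_max (Max_l G)) a"
      using b by (auto simp: zero_hull_def zeros_max_def principal_l_def)
  next
    fix b assume "b \<in> zero_hull G (zeros_max (Max_l G)) a"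
    then show "b \<in> principal_l G a"
      using Y[unfolded yosida_iff] a by (auto simp: zero_hull_def zeros_max_def)
  qed
  then show "\<exists>M \<subseteq> Max_l G. Inter_l G M = {\<one>} \<and>
     (\<forall>a\<in>carrier G. principal_l G a = zero_hull G (zeros_max M) a)"
    using yosida_Inter_Max[OF Y] by (intro exI[of _ "Max_l G"]) simp
next
  assume "\<exists>M \<subseteq> Max_l G. Inter_l G M = {\<one>} \<and>
     (\<forall>a\<in>carrier G. principal_l G a = zero_hull G (zeros_max M) a)"
  then obtain M where M: "M \<subseteq> Max_l G"
    "\<forall>a\<in>carrier G. principal_l G a = zero_hull G (zeros_max M) a" by blast
  show "yosida G" unfolding yosida_iff
    using M by (auto simp: zero_hull_def zeros_max_def)
qed

text \<open>A subgroup \<open>H\<close> strictly above the kernel has an element \<open>w\<close>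
  with \<open>\<phi> w > 0\<close>, and the archimedean property of the reals makes every element
  bounded by \<open>H\<close>. The first alternative covers a map that vanishes everywhere.\<close>

lemma real_hom_kernel:
  fixes \<phi> :: "'a \<Rightarrow> real"
  assumes add: "\<And>x y. x \<in> carrier G \<Longrightarrow> y \<in> carrier G \<Longrightarrow> \<phi> (x \<otimes> y) = \<phi> x + \<phi> y"
    and join: "\<And>x y. x \<in> carrier G \<Longrightarrow> y \<in> carrier G \<Longrightarrow> \<phi> (x \<curlyvee> y) = max (\<phi> x) (\<phi> y)"
    and meet: "\<And>x y. x \<in> carrier G \<Longrightarrow> y \<in> carrier G \<Longrightarrow> \<phi> (x \<curlywedge> y) = min (\<phi> x) (\<phi> y)"
  defines "K \<equiv> {x \<in> carrier G. \<phi> x = 0}"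
  shows "K = carrier G \<or> K \<in> Max_l G"
proof -
  have one: "\<phi> \<one> = 0" using add[of \<one> \<one>] by simp
  have inv: "\<phi> (inv x) = - \<phi> x" if "x \<in> carrier G" for x
    using add[of x "inv x"] one that by simp
  have pow: "\<phi> (x [^] n) = real n * \<phi> x" if "x \<in> carrier G" for x and n :: nat
    using that by (induction n) (simp_all add: one add algebra_simps)
  have mono: "\<phi> x \<le> \<phi> y" if "x \<preceq> y" "x \<in> carrier G" "y \<in> carrier G" for x y
    using join[of x y] join_eqI[of x y y] that by simp
  have sub: "subgroup K G"
    by (rule subgroupI) (use one in \<open>auto simp: K_def inv add\<close>)
  have K: "convex_l_subgroup G K"
  proof (rule convex_l_subgroupI[OF sub])
    fix x y z assume "x \<in> K" "y \<in> K" "z \<in> carrier G" "x \<preceq> z" "z \<preceq> y"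
    then show "z \<in> K" using mono[of x z] mono[of z y] by (simp add: K_def)
  qed (auto simp: K_def join meet)
  have "H = K \<or> H = carrier G" if H: "convex_l_subgroup G H" "K \<subseteq> H" for H
  proof (cases "H = K")
    case False
    note D = convex_l_subgroupD[OF H(1)]
    obtain u where u: "u \<in> H" "u \<notin> K" using False H by blast
    define w where "w = \<bar>u\<bar>\<^sub>G"
    have w: "w \<in> H" "w \<in> carrier G" using u D(3,11) by (auto simp: w_def)
    have "\<phi> w = max (\<phi> u) (- \<phi> u)" using u D(3) join[of u "inv u"] inv by (simp add: w_def l_abs_def)
    moreover have "\<phi> u \<noteq> 0" using u D(3) by (simp add: K_def)
    ultimately have pos: "\<phi> w > 0" by linarith
    have bound: "\<exists>c\<in>H. b \<preceq> c" if b: "b \<in> carrier G" for b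
    proof -
      obtain n :: nat where n: "\<phi> b \<le> real n * \<phi> w"
        using reals_Archimedean3[OF pos] less_imp_le by blast
      \<comment> \<open>The excess of \<open>b\<close> over \<open>w^n\<close>: the choice of
        \<open>n\<close> makes the value of \<open>b \<otimes> inv (w^n)\<close> nonpositive, so
        joining with \<open>\<one>\<close> yields an element of the kernel.\<close>
      let ?d = "b \<otimes> inv (w [^] n) \<curlyvee> \<one>"
      have "\<phi> ?d = 0" using n b w by (simp add: join add inv pow one)
      then have "?d \<in> H" using H(2) b w by (auto simp: K_def)
      then have "?d \<otimes> w [^] n \<in> H" using D(6,10) w by blast
      moreover have "b \<preceq> ?d \<otimes> w [^] n" using b w mult_inv_le[of b "w [^] n" ?d] by simp
      ultimately show ?thesis by blast
    qed
    have "b \<in> H" if b: "b \<in> carrier G" for b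
    proof -
      obtain c d where c: "c \<in> H" "b \<preceq> c" and d: "d \<in> H" "inv b \<preceq> d"
        using bound[OF b] bound[OF inv_closed[OF b]] by blast
      have "inv d \<preceq> b" using inv_le_iff[of "inv b" d] b d D(3) by simp
      then show ?thesis using D(9)[of "inv d" c b] D(5) b c d by blast
    qed
    then show ?thesis using D(2) by blast
  qed simp
  then show ?thesis using K unfolding Max_l_def by blast
qed

text \<open>Each coordinate where \<open>a\<close> vanishes has as kernel either all of
  \<open>G\<close>, which contains \<open>b\<close> anyway, or a maximal subgroup containing
  \<open>a\<close>, to which the assumption on \<open>b\<close> applies.\<close>

lemma zero_representation_imp_yosida:
  assumes "zero_representation G X \<phi>"
  shows "yosida G"
  unfolding yosida_iff
proof (intro ballI impI)
  fix a b assume ab: "a \<in> carrier G" "b \<in> carrier G" "\<forall>m\<in>Max_l G. a \<in> m \<longrightarrow> b \<in> m"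
  have E: "l_embedding G (real_power X) \<phi>" and P: "principal_l G a = zero_hull G (zeros_map X \<phi>) a"
    using assms ab by (auto simp: zero_representation_def)
  have hom: "\<phi> (c \<otimes> d) x = \<phi> c x + \<phi> d x" "\<phi> (c \<curlyvee> d) x = max (\<phi> c x) (\<phi> d x)"
    "\<phi> (c \<curlywedge> d) x = min (\<phi> c x) (\<phi> d x)"
    if "x \<in> X" "c \<in> carrier G" "d \<in> carrier G" for c d x
    using E that unfolding l_embedding_real_power_iff[OF lgroup_axioms] by blast+
  have "\<phi> b x = 0" if x: "x \<in> X" "\<phi> a x = 0" for x
  proof -
    define K where "K = {c \<in> carrier G. \<phi> c x = 0}"
    have "K = carrier G \<or> K \<in> Max_l G" unfolding K_def
      by (rule real_hom_kernel[of "\<lambda>c. \<phi> c x"]) (simp_all only: hom[OF x(1)])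
    moreover have "a \<in> K" using ab x by (simp add: K_def)
    ultimately have "b \<in> K" using ab(2) bspec[OF ab(3), of K] by blast
    then show ?thesis by (simp add: K_def)
  qed
  then show "b \<in> principal_l G a" unfolding P using ab by (auto simp: zero_hull_def zeros_map_def)
qed

end

context hamiltonian_lgroup
begin

text \<open>The maximal subgroups themselves are the index set: at \<open>m\<close> stands a
  homomorphism with kernel \<open>m\<close>, so the zero set of \<open>a\<close> consists of the
  maximal subgroups containing \<open>a\<close>.\<close>

lemma yosida_imp_zero_representation:
  assumes Y: "yosida G"
  obtains \<phi> where "zero_representation G (Max_l G) \<phi>"
proof -
  let ?P = "\<lambda>m (\<psi> :: 'a \<Rightarrow> real). (\<forall>x\<in>carrier G. \<forall>y\<in>carrier G. \<psi> (x \<otimes> y) = \<psi> x + \<psi> y \<and>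
      \<psi> (x \<curlyvee> y) = max (\<psi> x) (\<psi> y) \<and> \<psi> (x \<curlywedge> y) = min (\<psi> x) (\<psi> y)) \<and>
    (\<forall>x\<in>carrier G. \<psi> x = 0 \<longleftrightarrow> x \<in> m)"
  have "\<exists>\<psi>. ?P m \<psi>" if m: "m \<in> Max_l G" for m
    by (rule Max_real_hom[OF m]) (rule exI, intro conjI ballI; assumption?; simp)
  then have "\<forall>m\<in>Max_l G. \<exists>\<psi>. ?P m \<psi>" by (rule ballI)
  then obtain h where P: "\<forall>m\<in>Max_l G. ?P m (h m)" by (rule bchoice[THEN exE])
  have h: "h m (x \<otimes> y) = h m x + h m y" "h m (x \<curlyvee> y) = max (h m x) (h m y)"
    "h m (x \<curlywedge> y) = min (h m x) (h m y)"
    if "m \<in> Max_l G" "x \<in> carrier G" "y \<in> carrier G" for m x y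
    using bspec[OF P that(1)] that(2,3) by blast+
  have ker: "h m x = 0 \<longleftrightarrow> x \<in> m" if "m \<in> Max_l G" "x \<in> carrier G" for m x
    using bspec[OF P that(1)] that(2) by blast
  define \<phi> where "\<phi> a = (\<lambda>m\<in>Max_l G. h m a)" for a
  have "l_embedding G (real_power (Max_l G)) \<phi>"
    unfolding l_embedding_real_power_iff[OF lgroup_axioms]
  proof (intro conjI ballI impI)
    fix a assume a: "a \<in> carrier G" "\<forall>m\<in>Max_l G. \<phi> a m = 0"
    then have "a \<in> Inter_l G (Max_l G)" by (simp add: Inter_l_def \<phi>_def ker)
    then show "a = \<one>" using yosida_Inter_Max[OF Y] by simp
  qed (auto simp: \<phi>_def h)
  moreover have "principal_l G a = zero_hull G (zeros_map (Max_l G) \<phi>) a" if a: "a \<in> carrier G" for a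
  proof (intro equalityI subsetI)
    fix b assume b: "b \<in> principal_l G a"
    then have "b \<in> carrier G" by (simp add: principal_l_def)
    moreover have "principal_l G a \<subseteq> m" if "m \<in> Max_l G" "a \<in> m" for m
      using that principal_subset_iff[OF _ a, of m] by (simp add: Max_l_def)
    ultimately show "b \<in> zero_hull G (zeros_map (Max_l G) \<phi>) a"
      using a b by (auto simp: zero_hull_def zeros_map_def \<phi>_def ker)
  next
    fix b assume "b \<in> zero_hull G (zeros_map (Max_l G) \<phi>) a"
    then have "b \<in> carrier G" "\<forall>m\<in>Max_l G. a \<in> m \<longrightarrow> b \<in> m"
      using a by (auto simp: zero_hull_def zeros_map_def \<phi>_def ker)
    then show "b \<in> principal_l G a" using Y[unfolded yosida_iff] a by blast
  qed
  ultimately show thesis using that by (auto simp: zero_representation_def)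
qed

end

section \<open>Identifying joins and meets, and restriction to
  \<open>\<ell>\<close>-subgroups\<close>

lemma least_lorder_iff:
  assumes "x \<in> carrier K" "y \<in> carrier K"
  shows "least (lorder K) s (Upper (lorder K) {x, y}) \<longleftrightarrow> s \<in> carrier K \<and> lle K x s \<and> lle K y s \<and>
    (\<forall>t\<in>carrier K. lle K x t \<longrightarrow> lle K y t \<longrightarrow> lle K s t)"
  using assms by (auto simp: least_def Upper_def lorder_def)

lemma greatest_lorder_iff:
  assumes "x \<in> carrier K" "y \<in> carrier K"
  shows "greatest (lorder K) s (Lower (lorder K) {x, y}) \<longleftrightarrow> s \<in> carrier K \<and> lle K s x \<and> lle K s y \<and>
    (\<forall>t\<in>carrier K. lle K t x \<longrightarrow> lle K t y \<longrightarrow> lle K t s)"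
  using assms by (auto simp: greatest_def Lower_def lorder_def)

text \<open>The join is defined by Hilbert choice, so a least upper bound is known to be the join
  only once antisymmetry makes it unique.\<close>

lemma join_eq_least:
  assumes s: "least L s (Upper L {x, y})"
    and antisym: "\<And>u v. \<lbrakk>u \<in> carrier L; v \<in> carrier L; u \<sqsubseteq>\<^bsub>L\<^esub> v; v \<sqsubseteq>\<^bsub>L\<^esub> u\<rbrakk> \<Longrightarrow> u = v"
  shows "x \<squnion>\<^bsub>L\<^esub> y = s"
  unfolding join_def sup_def
proof (rule some_equality)
  show "least L s (Upper L {x, y})" by (rule s)
  fix t assume "least L t (Upper L {x, y})"
  then show "t = s" using s by (intro antisym) (auto simp: least_def Upper_def)
qed

lemma meet_eq_greatest:
  assumes s: "greatest L s (Lower L {x, y})"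
    and antisym: "\<And>u v. \<lbrakk>u \<in> carrier L; v \<in> carrier L; u \<sqsubseteq>\<^bsub>L\<^esub> v; v \<sqsubseteq>\<^bsub>L\<^esub> u\<rbrakk> \<Longrightarrow> u = v"
  shows "x \<sqinter>\<^bsub>L\<^esub> y = s"
  unfolding meet_def inf_def
proof (rule some_equality)
  show "greatest L s (Lower L {x, y})" by (rule s)
  fix t assume "greatest L t (Lower L {x, y})"
  then show "t = s" using s by (intro antisym) (auto simp: greatest_def Lower_def)
qed

context lgroup
begin

context
  fixes H assumes H: "l_subgroup G H"
begin

interpretation S: subgroup H G
  using H by (simp add: l_subgroup_def)

lemma l_subgroup_least_greatest:
  assumes "x \<in> H" "y \<in> H"
  shows "least (lorder (G\<lparr>carrier := H\<rparr>)) (x \<curlyvee> y) (Upper (lorder (G\<lparr>carrier := H\<rparr>)) {x, y})"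
    and "greatest (lorder (G\<lparr>carrier := H\<rparr>)) (x \<curlywedge> y) (Lower (lorder (G\<lparr>carrier := H\<rparr>)) {x, y})"
proof -
  have "x \<curlyvee> y \<in> H" "x \<curlywedge> y \<in> H" "x \<in> carrier G" "y \<in> carrier G"
    using H assms by (auto simp: l_subgroup_def)
  then show "least (lorder (G\<lparr>carrier := H\<rparr>)) (x \<curlyvee> y) (Upper (lorder (G\<lparr>carrier := H\<rparr>)) {x, y})"
    "greatest (lorder (G\<lparr>carrier := H\<rparr>)) (x \<curlywedge> y) (Lower (lorder (G\<lparr>carrier := H\<rparr>)) {x, y})"
    using assms by (simp_all add: least_lorder_iff greatest_lorder_iff join_least meet_greatest)
qed

lemma lgroup_l_subgroup: "lgroup (G\<lparr>carrier := H\<rparr>)"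
proof (rule lgroup.intro)
  show "group (G\<lparr>carrier := H\<rparr>)" by (rule S.subgroup_is_group[OF is_group])
  show "lgroup_axioms (G\<lparr>carrier := H\<rparr>)"
  proof (rule lgroup_axioms.intro)
    show "lattice (lorder (G\<lparr>carrier := H\<rparr>))"
    proof -
      interpret P: partial_order "lorder (G\<lparr>carrier := H\<rparr>)"
        by unfold_locales
          (auto simp: lorder_def intro: le_antisym le_trans[OF _ _ S.mem_carrier S.mem_carrier S.mem_carrier])
      show ?thesis
      proof
        fix x y assume "x \<in> carrier (lorder (G\<lparr>carrier := H\<rparr>))" "y \<in> carrier (lorder (G\<lparr>carrier := H\<rparr>))"
        then have "x \<in> H" "y \<in> H" by (simp_all add: lorder_def)
        then show "\<exists>s. least (lorder (G\<lparr>carrier := H\<rparr>)) s (Upper (lorder (G\<lparr>carrier := H\<rparr>)) {x, y})"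
          "\<exists>s. greatest (lorder (G\<lparr>carrier := H\<rparr>)) s (Lower (lorder (G\<lparr>carrier := H\<rparr>)) {x, y})"
          using l_subgroup_least_greatest by blast+
      qed
    qed
  qed (use lle_translate in auto)
qed

lemma l_subgroup_join: "x \<in> H \<Longrightarrow> y \<in> H \<Longrightarrow> x \<squnion>\<^bsub>lorder (G\<lparr>carrier := H\<rparr>)\<^esub> y = x \<curlyvee> y"
  by (rule join_eq_least[OF l_subgroup_least_greatest(1)]) (auto simp: lorder_def intro: le_antisym)

lemma l_subgroup_meet: "x \<in> H \<Longrightarrow> y \<in> H \<Longrightarrow> x \<sqinter>\<^bsub>lorder (G\<lparr>carrier := H\<rparr>)\<^esub> y = x \<curlywedge> y"
  by (rule meet_eq_greatest[OF l_subgroup_least_greatest(2)]) (auto simp: lorder_def intro: le_antisym)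

text \<open>Absolute values, powers and order of \<open>H\<close> are those of \<open>G\<close>, so
  an element of \<open>H\<close> satisfies the same bound with the same exponent in both.\<close>

lemma l_subgroup_principal:
  assumes a: "a \<in> H"
  shows "principal_l (G\<lparr>carrier := H\<rparr>) a = principal_l G a \<inter> H"
proof -
  have abs: "l_abs (G\<lparr>carrier := H\<rparr>) x = \<bar>x\<bar>\<^sub>G" if "x \<in> H" for x
    using that by (simp add: l_abs_def l_subgroup_join S.subgroup_axioms)
  show ?thesis
    using a by (auto simp: principal_l_def abs nat_pow_consistent[symmetric])
qed

lemma zero_representation_l_subgroup:
  assumes rep: "zero_representation G X \<phi>"
  shows "zero_representation (G\<lparr>carrier := H\<rparr>) X \<phi>"
proof -
  have E: "l_embedding G (real_power X) \<phi>"
    and P: "\<And>a. a \<in> carrier G \<Longrightarrow> principal_l G a = zero_hull G (zeros_map X \<phi>) a"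
    using rep by (auto simp: zero_representation_def)
  have "l_embedding (G\<lparr>carrier := H\<rparr>) (real_power X) \<phi>"
    using E unfolding l_embedding_real_power_iff[OF lgroup_axioms] l_embedding_real_power_iff[OF lgroup_l_subgroup]
    by (auto simp: l_subgroup_join l_subgroup_meet)
  moreover have "principal_l (G\<lparr>carrier := H\<rparr>) a = zero_hull (G\<lparr>carrier := H\<rparr>) (zeros_map X \<phi>) a"
    if "a \<in> H" for a
    unfolding l_subgroup_principal[OF that] P[OF S.mem_carrier[OF that]] by (auto simp: zero_hull_def)
  ultimately show ?thesis by (simp add: zero_representation_def)
qed

end

end

text \<open>A zero representation of \<open>G\<close> restricts to \<open>H\<close> with the same
  index set, because principal subgroups and zero hulls are both merely intersected with
  \<open>H\<close>. For the converse \<open>H\<close> is \<open>G\<close> itself.\<close>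

lemma (in hamiltonian_lgroup) yosida_iff_l_subgroups:
  "yosida G \<longleftrightarrow> (\<forall>H. l_subgroup G H \<longrightarrow> yosida (G\<lparr>carrier := H\<rparr>))"
proof
  assume "yosida G"
  then obtain \<phi> where "zero_representation G (Max_l G) \<phi>" by (rule yosida_imp_zero_representation)
  then show "\<forall>H. l_subgroup G H \<longrightarrow> yosida (G\<lparr>carrier := H\<rparr>)"
    using lgroup.zero_representation_imp_yosida[OF lgroup_l_subgroup] zero_representation_l_subgroup by blast
next
  assume "\<forall>H. l_subgroup G H \<longrightarrow> yosida (G\<lparr>carrier := H\<rparr>)"
  moreover have "l_subgroup G (carrier G)" using convex_carrier by (simp add: convex_l_subgroup_def)
  ultimately have "yosida (G\<lparr>carrier := carrier G\<rparr>)" by blast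
  then show "yosida G" by simp
qed

subsection \<open>The patch topology and ideals of principal subgroups\<close>

context lgroup
begin

text \<open>Primality is stated for disjoint pairs only. Dividing \<open>|a|\<close> and
  \<open>|b|\<close> by their meet \<open>?w\<close> makes them disjoint, and if \<open>?w\<close>
  is in \<open>p\<close> the division can be undone inside \<open>p\<close>.\<close>

lemma prime_meet_mem_iff:
  assumes p: "p \<in> Spec_l G" and c: "a \<in> carrier G" "b \<in> carrier G"
  shows "\<bar>a\<bar>\<^sub>G \<curlywedge> \<bar>b\<bar>\<^sub>G \<in> p \<longleftrightarrow> a \<in> p \<or> b \<in> p"
proof -
  have conv: "convex_l_subgroup G p" using p by (simp add: Spec_l_def)
  note D = convex_l_subgroupD[OF conv]
  let ?w = "\<bar>a\<bar>\<^sub>G \<curlywedge> \<bar>b\<bar>\<^sub>G"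
  have w: "?w \<in> carrier G" "\<one> \<preceq> ?w" using c by (auto intro: meet_greatest)
  show ?thesis
  proof
    assume wp: "?w \<in> p"
    have "(\<bar>a\<bar>\<^sub>G \<otimes> inv ?w) \<curlywedge> (\<bar>b\<bar>\<^sub>G \<otimes> inv ?w) = \<one>"
      using c by (simp flip: meet_mult_distrib)
    then have "\<bar>a\<bar>\<^sub>G \<otimes> inv ?w \<in> p \<or> \<bar>b\<bar>\<^sub>G \<otimes> inv ?w \<in> p"
      using p c unfolding Spec_l_def by simp
    then have "\<bar>a\<bar>\<^sub>G \<otimes> inv ?w \<otimes> ?w \<in> p \<or> \<bar>b\<bar>\<^sub>G \<otimes> inv ?w \<otimes> ?w \<in> p" using D(6) wp by blast
    then have "\<bar>a\<bar>\<^sub>G \<in> p \<or> \<bar>b\<bar>\<^sub>G \<in> p" using c by (simp add: m_assoc)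
    then show "a \<in> p \<or> b \<in> p" using convex_abs_mem_iff[OF conv] c by blast
  next
    assume "a \<in> p \<or> b \<in> p"
    then have "\<bar>a\<bar>\<^sub>G \<in> p \<or> \<bar>b\<bar>\<^sub>G \<in> p" using D(11) by blast
    then show "?w \<in> p"
      using D(9)[OF D(4) _ w(1) w(2), of "\<bar>a\<bar>\<^sub>G"] D(9)[OF D(4) _ w(1) w(2), of "\<bar>b\<bar>\<^sub>G"] c by auto
  qed
qed

lemma convex_join_abs_mem_iff:
  assumes conv: "convex_l_subgroup G p" and c: "a \<in> carrier G" "b \<in> carrier G"
  shows "\<bar>a\<bar>\<^sub>G \<curlyvee> \<bar>b\<bar>\<^sub>G \<in> p \<longleftrightarrow> a \<in> p \<and> b \<in> p"
proof
  assume "\<bar>a\<bar>\<^sub>G \<curlyvee> \<bar>b\<bar>\<^sub>G \<in> p"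
  then show "a \<in> p \<and> b \<in> p" using convex_abs_le_mem[OF conv, of "\<bar>a\<bar>\<^sub>G \<curlyvee> \<bar>b\<bar>\<^sub>G"] c by simp
qed (use convex_l_subgroupD(7,11)[OF conv] in blast)

definition patch_basic :: "'a \<Rightarrow> 'a \<Rightarrow> 'a set set" where
  "patch_basic a b = {p \<in> Spec_l G. a \<notin> p \<and> b \<in> p}"

lemma patch_topology_eq:
  "patch_topology G = topology_generated_by {patch_basic a b | a b. a \<in> carrier G \<and> b \<in> carrier G}"
  by (simp add: patch_topology_def patch_basic_def)

lemma openin_patch_basic: "a \<in> carrier G \<Longrightarrow> b \<in> carrier G \<Longrightarrow> openin (patch_topology G) (patch_basic a b)"
  unfolding patch_topology_eq by (rule topology_generated_by_Basis) blast

text \<open>Closure under intersection makes the generating sets a base rather than just a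
  subbase.\<close>

lemma patch_basic_Int:
  assumes "a \<in> carrier G" "b \<in> carrier G" "c \<in> carrier G" "d \<in> carrier G"
  shows "patch_basic a b \<inter> patch_basic c d = patch_basic (\<bar>a\<bar>\<^sub>G \<curlywedge> \<bar>c\<bar>\<^sub>G) (\<bar>b\<bar>\<^sub>G \<curlyvee> \<bar>d\<bar>\<^sub>G)"
proof -
  have "\<bar>b\<bar>\<^sub>G \<curlyvee> \<bar>d\<bar>\<^sub>G \<in> p \<longleftrightarrow> b \<in> p \<and> d \<in> p" if "p \<in> Spec_l G" for p
    using that assms by (intro convex_join_abs_mem_iff) (auto simp: Spec_l_def)
  then show ?thesis using assms by (auto simp: patch_basic_def prime_meet_mem_iff)
qed

lemma openin_patch_topologyD:
  assumes "openin (patch_topology G) U" "p \<in> U"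
  shows "\<exists>a\<in>carrier G. \<exists>b\<in>carrier G. p \<in> patch_basic a b \<and> patch_basic a b \<subseteq> U"
proof -
  have "generate_topology_on {patch_basic a b | a b. a \<in> carrier G \<and> b \<in> carrier G} U"
    using assms(1) unfolding patch_topology_eq by (rule openin_topology_generated_by)
  then show ?thesis using assms(2)
  proof (induction arbitrary: p)
    case (Int U V)
    from Int.prems have p: "p \<in> U" "p \<in> V" by simp_all
    obtain a b where ab: "a \<in> carrier G" "b \<in> carrier G" "p \<in> patch_basic a b" "patch_basic a b \<subseteq> U"
      using Int.IH(1)[OF p(1)] by blast
    obtain c d where cd: "c \<in> carrier G" "d \<in> carrier G" "p \<in> patch_basic c d" "patch_basic c d \<subseteq> V"
      using Int.IH(2)[OF p(2)] by blast
    show ?case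
    proof (intro bexI conjI)
      show "p \<in> patch_basic (\<bar>a\<bar>\<^sub>G \<curlywedge> \<bar>c\<bar>\<^sub>G) (\<bar>b\<bar>\<^sub>G \<curlyvee> \<bar>d\<bar>\<^sub>G)"
        "patch_basic (\<bar>a\<bar>\<^sub>G \<curlywedge> \<bar>c\<bar>\<^sub>G) (\<bar>b\<bar>\<^sub>G \<curlyvee> \<bar>d\<bar>\<^sub>G) \<subseteq> U \<inter> V"
        unfolding patch_basic_Int[OF ab(1,2) cd(1,2), THEN sym] using ab(3,4) cd(3,4) by blast+
    qed (use ab cd in simp_all)
  next
    case (UN K)
    then obtain k where k: "k \<in> K" "p \<in> k" by blast
    then show ?case using UN.IH[OF k] k(1) by blast
  next
    case (Basis s)
    then show ?case by blast
  qed simp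
qed

text \<open>Density has to be tested only on the nonempty basic sets.\<close>

lemma patch_dense_iff:
  assumes M: "M \<subseteq> Spec_l G"
  shows "patch_topology G closure_of M = Spec_l G \<longleftrightarrow>
    (\<forall>a\<in>carrier G. \<forall>b\<in>carrier G. patch_basic a b \<noteq> {} \<longrightarrow> M \<inter> patch_basic a b \<noteq> {})"
proof
  assume dense: "patch_topology G closure_of M = Spec_l G"
  show "\<forall>a\<in>carrier G. \<forall>b\<in>carrier G. patch_basic a b \<noteq> {} \<longrightarrow> M \<inter> patch_basic a b \<noteq> {}"
  proof (intro ballI impI)
    fix a b assume ab: "a \<in> carrier G" "b \<in> carrier G" "patch_basic a b \<noteq> {}"
    then obtain p where p: "p \<in> patch_basic a b" by blast
    then have "p \<in> patch_topology G closure_of M" unfolding dense by (simp add: patch_basic_def)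
    then show "M \<inter> patch_basic a b \<noteq> {}"
      using p openin_patch_basic[OF ab(1,2)] unfolding in_closure_of by blast
  qed
next
  assume *: "\<forall>a\<in>carrier G. \<forall>b\<in>carrier G. patch_basic a b \<noteq> {} \<longrightarrow> M \<inter> patch_basic a b \<noteq> {}"
  \<comment> \<open>The space underlying a generated topology is the union of the generators.
    Properness of \<open>p\<close> supplies an \<open>a\<close> outside it, and then
    \<open>patch_basic a \<one>\<close> contains \<open>p\<close>.\<close>
  have "Spec_l G \<subseteq> \<Union>{patch_basic a b | a b. a \<in> carrier G \<and> b \<in> carrier G}"
  proof
    fix p assume p: "p \<in> Spec_l G"
    then have c: "convex_l_subgroup G p" "p \<noteq> carrier G" by (simp_all add: Spec_l_def)
    then obtain a where a: "a \<in> carrier G" "a \<notin> p" using convex_l_subgroupD(2)[OF c(1)] by blast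
    then have "p \<in> patch_basic a \<one>"
      using p convex_l_subgroupD(4)[OF c(1)] by (simp add: patch_basic_def)
    then show "p \<in> \<Union>{patch_basic a b | a b. a \<in> carrier G \<and> b \<in> carrier G}"
      using a(1) one_closed by blast
  qed
  then have top: "topspace (patch_topology G) = Spec_l G"
    unfolding patch_topology_eq topology_generated_by_topspace by (auto simp: patch_basic_def)
  show "patch_topology G closure_of M = Spec_l G"
  proof
    show "patch_topology G closure_of M \<subseteq> Spec_l G"
      using closure_of_subset_topspace[of "patch_topology G" M] top by simp
    show "Spec_l G \<subseteq> patch_topology G closure_of M"
    proof
      fix p assume p: "p \<in> Spec_l G"
      have "\<exists>y\<in>M. y \<in> U" if U: "p \<in> U" "openin (patch_topology G) U" for U
      proof -
        obtain a b where ab: "a \<in> carrier G" "b \<in> carrier G" "p \<in> patch_basic a b" "patch_basic a b \<subseteq> U"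
          using openin_patch_topologyD[OF U(2,1)] by blast
        then have "M \<inter> patch_basic a b \<noteq> {}" using * by blast
        then show ?thesis using ab(4) by blast
      qed
      then show "p \<in> patch_topology G closure_of M" unfolding in_closure_of top using p by blast
    qed
  qed
qed

end

text \<open>The basic set of \<open>a\<close> and \<open>b\<close> is nonempty exactly when
  \<open>a\<close> lies outside \<open>G(b)\<close>: primes containing \<open>b\<close> contain
  \<open>G(b)\<close>, and conversely a value of \<open>a\<close> above \<open>G(b)\<close> is
  prime. Density therefore asks for maximal subgroups that separate the same pairs.\<close>

lemma (in hamiltonian_lgroup) yosida_iff_patch_dense:
  "yosida G \<longleftrightarrow> (\<exists>M \<subseteq> Max_l G. Inter_l G M = {\<one>} \<and> patch_topology G closure_of M = Spec_l G)"
proof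
  assume Y: "yosida G"
  have "Max_l G \<inter> patch_basic a b \<noteq> {}"
    if ab: "a \<in> carrier G" "b \<in> carrier G" "patch_basic a b \<noteq> {}" for a b
  proof -
    obtain p where p: "p \<in> Spec_l G" "a \<notin> p" "b \<in> p" using ab by (auto simp: patch_basic_def)
    then have "a \<notin> principal_l G b"
      using principal_subset_iff[OF _ ab(2), of p] by (auto simp: Spec_l_def)
    then obtain m where "m \<in> Max_l G" "b \<in> m" "a \<notin> m" using Y[unfolded yosida_iff] ab by blast
    then show ?thesis using Max_subset_Spec by (auto simp: patch_basic_def)
  qed
  then have "patch_topology G closure_of (Max_l G) = Spec_l G"
    unfolding patch_dense_iff[OF Max_subset_Spec] by simp
  then show "\<exists>M \<subseteq> Max_l G. Inter_l G M = {\<one>} \<and> patch_topology G closure_of M = Spec_l G"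
    using yosida_Inter_Max[OF Y] by blast
next
  assume "\<exists>M \<subseteq> Max_l G. Inter_l G M = {\<one>} \<and> patch_topology G closure_of M = Spec_l G"
  then obtain M where M: "M \<subseteq> Max_l G" "patch_topology G closure_of M = Spec_l G" by blast
  then have "M \<subseteq> Spec_l G" using Max_subset_Spec by blast
  from M(2)[unfolded patch_dense_iff[OF this]]
  have dense: "M \<inter> patch_basic a b \<noteq> {}" if "a \<in> carrier G" "b \<in> carrier G" "patch_basic a b \<noteq> {}" for a b
    using that by simp
  show "yosida G" unfolding yosida_iff
  proof (intro ballI impI)
    fix a b assume ab: "a \<in> carrier G" "b \<in> carrier G" "\<forall>m\<in>Max_l G. a \<in> m \<longrightarrow> b \<in> m"
    show "b \<in> principal_l G a"
    proof (rule ccontr)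
      assume "b \<notin> principal_l G a"
      then obtain p where "p \<in> Spec_l G" "a \<in> p" "b \<notin> p"
        using ex_prime_separating[OF ab(2,1)] by blast
      then have "patch_basic b a \<noteq> {}" by (auto simp: patch_basic_def)
      then have "M \<inter> patch_basic b a \<noteq> {}" using dense ab by simp
      then show False using ab(3) M(1) by (auto simp: patch_basic_def)
    qed
  qed
qed

section \<open>Ideals of the semilattice of principal convex subgroups\<close>

context lgroup
begin

abbreviation PL where "PL \<equiv> principal_lattice G"

lemma principal_lattice_simps [simp]:
  "carrier PL = principal_l G ` carrier G" "(X \<sqsubseteq>\<^bsub>PL\<^esub> Y) = (X \<subseteq> Y)"
  by (simp_all add: principal_lattice_def)

lemma principal_lattice_join:
  assumes "a \<in> carrier G" "b \<in> carrier G"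
  shows "principal_l G a \<squnion>\<^bsub>PL\<^esub> principal_l G b = principal_l G (\<bar>a\<bar>\<^sub>G \<curlyvee> \<bar>b\<bar>\<^sub>G)"
proof (rule join_eq_least)
  have *: "principal_l G (\<bar>a\<bar>\<^sub>G \<curlyvee> \<bar>b\<bar>\<^sub>G) \<subseteq> principal_l G c \<longleftrightarrow>
      principal_l G a \<subseteq> principal_l G c \<and> principal_l G b \<subseteq> principal_l G c" if "c \<in> carrier G" for c
    using convex_principal[OF that] assms by (simp add: principal_subset_iff convex_join_abs_mem_iff)
  have "principal_l G a \<subseteq> principal_l G (\<bar>a\<bar>\<^sub>G \<curlyvee> \<bar>b\<bar>\<^sub>G) \<and> principal_l G b \<subseteq> principal_l G (\<bar>a\<bar>\<^sub>G \<curlyvee> \<bar>b\<bar>\<^sub>G)"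
    using *[of "\<bar>a\<bar>\<^sub>G \<curlyvee> \<bar>b\<bar>\<^sub>G"] assms by blast
  then show "least PL (principal_l G (\<bar>a\<bar>\<^sub>G \<curlyvee> \<bar>b\<bar>\<^sub>G)) (Upper PL {principal_l G a, principal_l G b})"
    using assms * by (auto simp: least_def Upper_def)
qed (auto simp: principal_lattice_def)

lemma order_ideal_of_convex:
  assumes H: "convex_l_subgroup G H"
  shows "order_ideal PL (principal_l G ` H)"
  unfolding order_ideal_def
proof (intro conjI ballI impI)
  note D = convex_l_subgroupD[OF H]
  show "principal_l G ` H \<subseteq> carrier PL" "principal_l G ` H \<noteq> {}" using D(3,4) by auto
  show "Y \<in> principal_l G ` H"
    if X: "X \<in> principal_l G ` H" and Y: "Y \<in> carrier PL" and le: "Y \<sqsubseteq>\<^bsub>PL\<^esub> X" for X Y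
  proof -
    obtain x y where xy: "x \<in> H" "X = principal_l G x" "y \<in> carrier G" "Y = principal_l G y"
      using X Y by auto
    have "x \<in> carrier G" using xy D(3) by blast
    then have "y \<in> H"
      using le xy mem_principal[of y] principal_subset_iff[OF H, of x] by auto
    then show ?thesis using xy by blast
  qed
  show "X \<squnion>\<^bsub>PL\<^esub> Y \<in> principal_l G ` H" if XY: "X \<in> principal_l G ` H" "Y \<in> principal_l G ` H" for X Y
  proof -
    obtain x y where xy: "x \<in> H" "y \<in> H" "X = principal_l G x" "Y = principal_l G y" using XY by blast
    then show ?thesis using D(3,7,11) by (simp add: principal_lattice_join)
  qed
qed

lemma principal_mem_image_iff:
  assumes H: "convex_l_subgroup G H" and x: "x \<in> carrier G"
  shows "principal_l G x \<in> principal_l G ` H \<longleftrightarrow> x \<in> H"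
proof
  assume "principal_l G x \<in> principal_l G ` H"
  then obtain y where y: "y \<in> H" "principal_l G x = principal_l G y" by blast
  then have "x \<in> principal_l G y" using mem_principal[OF x] by simp
  moreover have "y \<in> carrier G" using y convex_l_subgroupD(3)[OF H] by blast
  ultimately show "x \<in> H" using principal_subset_iff[OF H, of y] y by blast
qed simp

text \<open>Two elements \<open>x\<close>, \<open>y\<close> of the set lie in the principal subgroup
  of the join of \<open>|x|\<close> and \<open>|y|\<close>, which belongs to \<open>W\<close>. All
  closure properties are inherited from this one convex subgroup.\<close>

lemma convex_of_order_ideal:
  assumes W: "order_ideal PL W"
  shows "convex_l_subgroup G {x \<in> carrier G. principal_l G x \<in> W}" (is "convex_l_subgroup G ?H")
proof -
  have gen: "z \<in> ?H" if z: "z \<in> principal_l G (\<bar>x\<bar>\<^sub>G \<curlyvee> \<bar>y\<bar>\<^sub>G)" and xy: "x \<in> ?H" "y \<in> ?H" for x y z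
  proof -
    let ?j = "\<bar>x\<bar>\<^sub>G \<curlyvee> \<bar>y\<bar>\<^sub>G"
    have c: "x \<in> carrier G" "y \<in> carrier G" "z \<in> carrier G" using z xy by (auto simp: principal_l_def)
    have "principal_l G x \<squnion>\<^bsub>PL\<^esub> principal_l G y \<in> W" using W xy unfolding order_ideal_def by blast
    then have "principal_l G ?j \<in> W" using c by (simp add: principal_lattice_join)
    moreover have "principal_l G z \<subseteq> principal_l G ?j"
      using z c by (simp add: principal_subset_iff convex_principal)
    ultimately show ?thesis using W c unfolding order_ideal_def by simp
  qed
  have mem: "x \<in> principal_l G (\<bar>x\<bar>\<^sub>G \<curlyvee> \<bar>y\<bar>\<^sub>G)" "y \<in> principal_l G (\<bar>x\<bar>\<^sub>G \<curlyvee> \<bar>y\<bar>\<^sub>G)"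
    and conv: "convex_l_subgroup G (principal_l G (\<bar>x\<bar>\<^sub>G \<curlyvee> \<bar>y\<bar>\<^sub>G))"
    if "x \<in> ?H" "y \<in> ?H" for x y
  proof -
    show c: "convex_l_subgroup G (principal_l G (\<bar>x\<bar>\<^sub>G \<curlyvee> \<bar>y\<bar>\<^sub>G))"
      using that by (intro convex_principal) auto
    show "x \<in> principal_l G (\<bar>x\<bar>\<^sub>G \<curlyvee> \<bar>y\<bar>\<^sub>G)" "y \<in> principal_l G (\<bar>x\<bar>\<^sub>G \<curlyvee> \<bar>y\<bar>\<^sub>G)"
      using convex_join_abs_mem_iff[OF c, of x y] mem_principal[of "\<bar>x\<bar>\<^sub>G \<curlyvee> \<bar>y\<bar>\<^sub>G"] that by auto
  qed
  obtain a where a: "a \<in> carrier G" "principal_l G a \<in> W"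
  proof -
    obtain X where "X \<in> W" "X \<in> carrier PL" using W unfolding order_ideal_def by blast
    then show thesis using that by auto
  qed
  have "subgroup ?H G"
  proof (rule subgroupI)
    show "?H \<noteq> {}" using a by blast
    show "inv x \<in> ?H" if "x \<in> ?H" for x
      using gen[OF convex_l_subgroupD(5)[OF conv mem(1)] that that] that by blast
    show "x \<otimes> y \<in> ?H" if "x \<in> ?H" "y \<in> ?H" for x y
      using gen[OF convex_l_subgroupD(6)[OF conv mem] that] that by blast
  qed auto
  then show ?thesis
  proof (rule convex_l_subgroupI)
    show "x \<curlyvee> y \<in> ?H" if "x \<in> ?H" "y \<in> ?H" for x y
      using gen[OF convex_l_subgroupD(7)[OF conv mem] that] that by blast
    show "x \<curlywedge> y \<in> ?H" if "x \<in> ?H" "y \<in> ?H" for x y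
      using gen[OF convex_l_subgroupD(8)[OF conv mem] that] that by blast
    show "z \<in> ?H" if "x \<in> ?H" "y \<in> ?H" "z \<in> carrier G" "x \<preceq> z" "z \<preceq> y" for x y z
      using gen[OF convex_l_subgroupD(9)[OF conv mem that(3-5)] that(1,2)] that(1,2) by blast
  qed
qed

lemma order_ideal_carrier: "order_ideal PL (carrier PL)"
  using order_ideal_of_convex[OF convex_carrier] by simp

lemma order_ideal_principal_ideal:
  assumes b: "b \<in> carrier G"
  shows "order_ideal PL (principal_ideal PL (principal_l G b))"
proof -
  have "principal_ideal PL (principal_l G b) = principal_l G ` principal_l G b"
    using principal_subset_iff[OF convex_principal[OF b]]
    by (auto simp: principal_ideal_def principal_l_def)
  then show ?thesis using order_ideal_of_convex[OF convex_principal[OF b]] by simp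
qed

end

text \<open>The assumption that the whole carrier is an ideal keeps the intersection inside
  \<open>L\<close>; for \<open>PL\<close> it is supplied by
  \<open>order_ideal_carrier\<close>.\<close>

lemma ideal_lattice_join:
  assumes A: "order_ideal L A" and B: "order_ideal L B" and top: "order_ideal L (carrier L)"
  shows "A \<squnion>\<^bsub>ideal_lattice L\<^esub> B = \<Inter>{J. order_ideal L J \<and> A \<subseteq> J \<and> B \<subseteq> J}" (is "_ = ?I")
proof (rule join_eq_least)
  have "A \<noteq> {}" "A \<subseteq> ?I" using A by (auto simp: order_ideal_def)
  then have "?I \<noteq> {}" by blast
  have mem: "A \<subseteq> carrier L" "B \<subseteq> carrier L" using A B by (auto simp: order_ideal_def)
  have "order_ideal L ?I" unfolding order_ideal_def[of L ?I]
  proof (intro conjI ballI impI)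
    show "?I \<subseteq> carrier L" using top mem by blast
    show "?I \<noteq> {}" by fact
    fix x assume x: "x \<in> ?I"
    show "y \<in> ?I" if "y \<in> carrier L" "y \<sqsubseteq>\<^bsub>L\<^esub> x" for y
      using x that unfolding order_ideal_def by blast
    show "x \<squnion>\<^bsub>L\<^esub> y \<in> ?I" if "y \<in> ?I" for y
      using x that unfolding order_ideal_def by blast
  qed
  then show "least (ideal_lattice L) ?I (Upper (ideal_lattice L) {A, B})"
    using A B by (auto simp: least_def Upper_def ideal_lattice_def)
qed (auto simp: ideal_lattice_def)

text \<open>An ideal \<open>W\<close> that becomes everything once \<open>G(b)\<close> is added
  forces each value of \<open>b\<close> above the subgroup of \<open>W\<close> to be maximal.
  Conversely a maximal subgroup that contains \<open>a\<close> and misses \<open>b\<close> yields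
  such an ideal.\<close>

lemma (in lgroup) ideally_conjunctive_iff_yosida: "ideally_conjunctive PL \<longleftrightarrow> yosida G"
proof
  assume IC: "ideally_conjunctive PL"
  show "yosida G" unfolding yosida_iff
  proof (intro ballI impI, rule ccontr)
    fix a b assume ab: "a \<in> carrier G" "b \<in> carrier G" and max: "\<forall>m\<in>Max_l G. a \<in> m \<longrightarrow> b \<in> m"
      and "b \<notin> principal_l G a"
    then have "\<not> principal_l G b \<sqsubseteq>\<^bsub>PL\<^esub> principal_l G a"
      by (simp add: principal_subset_iff convex_principal)
    then obtain W where W: "order_ideal PL W" "principal_l G a \<in> W" "W \<noteq> carrier PL"
      and join: "W \<squnion>\<^bsub>ideal_lattice PL\<^esub> principal_ideal PL (principal_l G b) = carrier PL"
      using IC[unfolded ideally_conjunctive_def, rule_format, of "principal_l G a" "principal_l G b"] ab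
      by auto
    let ?B = "principal_ideal PL (principal_l G b)"
    have all: "J = carrier PL" if J: "order_ideal PL J" "W \<subseteq> J" "principal_l G b \<in> J" for J
    proof
      show "J \<subseteq> carrier PL" using J by (simp add: order_ideal_def)
      have "?B \<subseteq> J" using J unfolding order_ideal_def principal_ideal_def by blast
      then show "carrier PL \<subseteq> J"
        using join J unfolding ideal_lattice_join[OF W(1) order_ideal_principal_ideal[OF ab(2)] order_ideal_carrier]
        by blast
    qed
    define H where "H = {x \<in> carrier G. principal_l G x \<in> W}"
    have H: "convex_l_subgroup G H" unfolding H_def by (rule convex_of_order_ideal[OF W(1)])
    have "b \<notin> H" using all[OF W(1)] W(3) by (auto simp: H_def)
    then obtain p where p: "is_value b p" "H \<subseteq> p" using ex_value[OF H] by blast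
    have cp: "convex_l_subgroup G p" "b \<notin> p" using p by (simp_all add: is_value_def)
    \<comment> \<open>A proper \<open>K\<close> above \<open>p\<close> cannot contain
      \<open>b\<close>, since its ideal would then contain \<open>W\<close> and \<open>G(b)\<close>
      and hence be everything. So \<open>K\<close> misses \<open>b\<close>, and the value property
      gives \<open>K = p\<close>.\<close>
    have "K = p" if K: "convex_l_subgroup G K" "p \<subseteq> K" "K \<noteq> carrier G" for K
    proof (cases "b \<in> K")
      case True
      have "W \<subseteq> principal_l G ` H" using W(1) by (auto simp: H_def order_ideal_def)
      then have "W \<subseteq> principal_l G ` K" using p(2) K(2) by blast
      then have eq: "principal_l G ` K = carrier PL" using True by (intro all order_ideal_of_convex K) auto
      have "x \<in> K" if "x \<in> carrier G" for x
        using principal_mem_image_iff[OF K(1) that] eq that by simp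
      then show ?thesis using K convex_l_subgroupD(2)[OF K(1)] by blast
    next
      case False
      then show ?thesis using p K by (simp add: is_value_def)
    qed
    then have "p \<in> Max_l G" using cp ab unfolding Max_l_def by blast
    moreover have "a \<in> p" using ab W p by (auto simp: H_def)
    ultimately show False using max cp by blast
  qed
next
  assume Y: "yosida G"
  show "ideally_conjunctive PL" unfolding ideally_conjunctive_def
  proof (intro ballI impI)
    fix A B assume "A \<in> carrier PL" "B \<in> carrier PL" and nle: "\<not> B \<sqsubseteq>\<^bsub>PL\<^esub> A"
    then obtain a b where a: "a \<in> carrier G" "A = principal_l G a" and b: "b \<in> carrier G" "B = principal_l G b"
      by auto
    then have "b \<notin> principal_l G a" using nle by (simp add: principal_subset_iff convex_principal)
    then obtain m where m: "m \<in> Max_l G" "a \<in> m" "b \<notin> m" using Y[unfolded yosida_iff] a b by blast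
    have cm: "convex_l_subgroup G m" using m by (simp add: Max_l_def)
    define W where "W = principal_l G ` m"
    have W: "order_ideal PL W" unfolding W_def by (rule order_ideal_of_convex[OF cm])
    have "B \<notin> W" using principal_mem_image_iff[OF cm b(1)] m b by (simp add: W_def)
    have "carrier PL \<subseteq> J" if J: "order_ideal PL J" "W \<subseteq> J" "principal_ideal PL B \<subseteq> J" for J
    proof -
      \<comment> \<open>The convex subgroup of \<open>J\<close> contains \<open>m\<close> and also
        \<open>b\<close>, which is outside \<open>m\<close>, so maximality makes it all of
        \<open>G\<close>.\<close>
      let ?K = "{x \<in> carrier G. principal_l G x \<in> J}"
      have K: "convex_l_subgroup G ?K" by (rule convex_of_order_ideal[OF J(1)])
      have "m \<subseteq> ?K" using J(2) convex_l_subgroupD(2)[OF cm] by (auto simp: W_def)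
      moreover have "b \<in> ?K" using J(3) b by (auto simp: principal_ideal_def)
      ultimately have "?K = carrier G" using m K unfolding Max_l_def by blast
      then show ?thesis by auto
    qed
    then have "W \<squnion>\<^bsub>ideal_lattice PL\<^esub> principal_ideal PL B = carrier PL"
      unfolding b(2) ideal_lattice_join[OF W order_ideal_principal_ideal[OF b(1)] order_ideal_carrier]
      using order_ideal_carrier W b by (intro equalityI) (auto simp: order_ideal_def principal_ideal_def)
    moreover have "A \<in> W" using a m by (simp add: W_def)
    moreover have "W \<noteq> carrier PL" using \<open>B \<notin> W\<close> b by auto
    ultimately show "\<exists>W. order_ideal PL W \<and> A \<in> W \<and> W \<noteq> carrier PL \<and>
         W \<squnion>\<^bsub>ideal_lattice PL\<^esub> principal_ideal PL B = carrier PL"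
      using W by blast
  qed
qed

subsection \<open>Quotients\<close>

context hamiltonian_lgroup
begin

context
  fixes N assumes N: "convex_l_subgroup G N" "N \<lhd> G"
begin

interpretation N: normal N G by (rule N(2))

abbreviation Q where "Q \<equiv> l_quotient G N"

lemma carrier_quotient: "carrier Q = (\<lambda>x. N #> x) ` carrier G"
  by (simp add: l_quotient_def monoid.defs carrier_FactGroup)

lemma coset_closed [simp]: "x \<in> carrier G \<Longrightarrow> N #> x \<in> carrier Q"
  by (auto simp: carrier_quotient)

lemma one_quotient: "\<one>\<^bsub>Q\<^esub> = N #> \<one>"
  using N.subset by (simp add: l_quotient_def monoid.defs)

lemma mult_quotient: "x \<in> carrier G \<Longrightarrow> y \<in> carrier G \<Longrightarrow> (N #> x) \<otimes>\<^bsub>Q\<^esub> (N #> y) = N #> (x \<otimes> y)"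
  by (simp add: l_quotient_def monoid.defs N.rcos_sum)

text \<open>\<open>l_quotient\<close> attaches an order to \<open>G Mod N\<close>, and the group
  axioms see only the monoid fields.\<close>

lemma group_quotient: "group Q"
proof -
  have "group (G Mod N)" by (rule N.factorgroup_is_group)
  then show ?thesis
    by (simp add: l_quotient_def monoid.defs group_def group_axioms_def monoid_def Units_def)
qed

lemma inv_quotient:
  assumes x: "x \<in> carrier G"
  shows "inv\<^bsub>Q\<^esub> (N #> x) = N #> inv x"
  by (rule group.inv_equality[OF group_quotient]) (use x in \<open>simp_all add: mult_quotient one_quotient\<close>)

text \<open>Varying both representatives gives nothing more than varying one: the factor
  \<open>h\<close> on the left is moved to the right as \<open>inv h\<close>.\<close>

lemma le_quotient_iff:
  assumes "x \<in> carrier G" "y \<in> carrier G"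
  shows "lle Q (N #> x) (N #> y) \<longleftrightarrow> le_mod N x y"
proof -
  note D = convex_l_subgroupD[OF N(1)]
  have "lle Q (N #> x) (N #> y) \<longleftrightarrow> (\<exists>h\<in>N. \<exists>k\<in>N. h \<otimes> x \<preceq> k \<otimes> y)"
    by (auto simp: l_quotient_def monoid.defs r_coset_def)
  also have "\<dots> \<longleftrightarrow> le_mod N x y"
  proof
    assume "\<exists>h\<in>N. \<exists>k\<in>N. h \<otimes> x \<preceq> k \<otimes> y"
    then obtain h k where hk: "h \<in> N" "k \<in> N" "h \<otimes> x \<preceq> k \<otimes> y" by blast
    have "x \<preceq> inv h \<otimes> k \<otimes> y"
      using hk D(3) assms le_inv_mult[of x h "k \<otimes> y"] by (simp add: m_assoc)
    moreover have "inv h \<otimes> k \<in> N" using hk D(5,6) by blast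
    ultimately show "le_mod N x y" unfolding le_mod_def by blast
  next
    assume "le_mod N x y"
    then obtain k where k: "k \<in> N" "x \<preceq> k \<otimes> y" by (auto simp: le_mod_def)
    have "\<one> \<otimes> x \<preceq> k \<otimes> y" using k assms by simp
    then show "\<exists>h\<in>N. \<exists>k\<in>N. h \<otimes> x \<preceq> k \<otimes> y" using k(1) D(4) by blast
  qed
  finally show ?thesis .
qed

lemma coset_eq_iff:
  assumes "x \<in> carrier G" "y \<in> carrier G"
  shows "N #> x = N #> y \<longleftrightarrow> x \<otimes> inv y \<in> N"
proof
  assume "N #> x = N #> y"
  then have "x \<in> N #> y" using rcos_self[OF assms(1) N.subgroup_axioms] by simp
  then show "x \<otimes> inv y \<in> N" using N.rcos_module[OF is_group assms(2,1)] by simp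
next
  assume "x \<otimes> inv y \<in> N"
  then have "x \<in> N #> y" using N.rcos_module[OF is_group assms(2,1)] by simp
  then show "N #> x = N #> y" using repr_independence[OF _ assms(2) N.subgroup_axioms] by simp
qed

text \<open>This is where convexity of \<open>N\<close> enters: modulo \<open>N\<close> the element
  \<open>x \<otimes> inv y\<close> lies both below and above \<open>\<one>\<close>, so it is caught
  between two elements of \<open>N\<close>.\<close>

lemma quotient_antisym:
  assumes "X \<in> carrier Q" "Y \<in> carrier Q" "lle Q X Y" "lle Q Y X"
  shows "X = Y"
proof -
  obtain x y where xy: "x \<in> carrier G" "y \<in> carrier G" "X = N #> x" "Y = N #> y"
    using assms by (auto simp: carrier_quotient)
  then have "le_mod N x y" "le_mod N y x" using assms by (simp_all add: le_quotient_iff)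
  then have "le_mod N (x \<otimes> inv y) \<one>" "le_mod N \<one> (x \<otimes> inv y)"
    using le_mod_mult_cancel[OF N(1), of x y \<one> "inv y"] le_mod_mult_cancel[OF N(1), of y x \<one> "inv y"] xy
    by simp_all
  then have "x \<otimes> inv y \<in> N" using le_mod_one_iff[OF N(1), of "x \<otimes> inv y"] xy by simp
  then show ?thesis using xy by (simp add: coset_eq_iff)
qed

lemma join_quotient:
  assumes xy: "x \<in> carrier G" "y \<in> carrier G"
  shows "(N #> x) \<squnion>\<^bsub>lorder Q\<^esub> (N #> y) = N #> (x \<curlyvee> y)"
proof (rule join_eq_least)
  note D = convex_l_subgroupD[OF N(1)]
  have "le_mod N (x \<curlyvee> y) z" if z: "z \<in> carrier G" and le: "le_mod N x z" "le_mod N y z" for z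
  proof -
    obtain h k where h: "h \<in> N" "x \<preceq> h \<otimes> z" and k: "k \<in> N" "y \<preceq> k \<otimes> z"
      using le by (auto simp: le_mod_def)
    have c: "h \<in> carrier G" "k \<in> carrier G" using h k D(3) by auto
    \<comment> \<open>The two witnesses are enlarged to the common one
      \<open>h \<curlyvee> k\<close>, which is still in \<open>N\<close>.\<close>
    have "x \<preceq> (h \<curlyvee> k) \<otimes> z" "y \<preceq> (h \<curlyvee> k) \<otimes> z"
      using c xy z by (auto intro: le_trans[OF h(2)] le_trans[OF k(2)] simp: mult_le_cancel_right)
    then have "x \<curlyvee> y \<preceq> (h \<curlyvee> k) \<otimes> z" using c xy z by (intro join_least) auto
    moreover have "h \<curlyvee> k \<in> N" using h k D(7) by blast
    ultimately show ?thesis unfolding le_mod_def by blast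
  qed
  then have "\<forall>Z\<in>carrier Q. lle Q (N #> x) Z \<longrightarrow> lle Q (N #> y) Z \<longrightarrow> lle Q (N #> (x \<curlyvee> y)) Z"
    using xy by (auto simp: carrier_quotient le_quotient_iff)
  then show "least (lorder Q) (N #> (x \<curlyvee> y)) (Upper (lorder Q) {N #> x, N #> y})"
    using xy by (simp add: least_lorder_iff le_quotient_iff le_mod_of_le[OF N(1)])
qed (rule quotient_antisym; simp add: lorder_def)

lemma meet_quotient:
  assumes xy: "x \<in> carrier G" "y \<in> carrier G"
  shows "(N #> x) \<sqinter>\<^bsub>lorder Q\<^esub> (N #> y) = N #> (x \<curlywedge> y)"
proof (rule meet_eq_greatest)
  note D = convex_l_subgroupD[OF N(1)]
  have "le_mod N z (x \<curlywedge> y)" if z: "z \<in> carrier G" and le: "le_mod N z x" "le_mod N z y" for z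
  proof -
    obtain h k where h: "h \<in> N" "z \<preceq> h \<otimes> x" and k: "k \<in> N" "z \<preceq> k \<otimes> y"
      using le by (auto simp: le_mod_def)
    have c: "h \<in> carrier G" "k \<in> carrier G" using h k D(3) by auto
    have "z \<preceq> (h \<curlyvee> k) \<otimes> x" "z \<preceq> (h \<curlyvee> k) \<otimes> y"
      using c xy z by (auto intro: le_trans[OF h(2)] le_trans[OF k(2)] simp: mult_le_cancel_right)
    then have "z \<preceq> (h \<curlyvee> k) \<otimes> (x \<curlywedge> y)"
      using c xy z by (simp add: mult_meet_distrib meet_greatest)
    moreover have "h \<curlyvee> k \<in> N" using h k D(7) by blast
    ultimately show ?thesis unfolding le_mod_def by blast
  qed
  then have "\<forall>Z\<in>carrier Q. lle Q Z (N #> x) \<longrightarrow> lle Q Z (N #> y) \<longrightarrow> lle Q Z (N #> (x \<curlywedge> y))"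
    using xy by (auto simp: carrier_quotient le_quotient_iff)
  then show "greatest (lorder Q) (N #> (x \<curlywedge> y)) (Lower (lorder Q) {N #> x, N #> y})"
    using xy by (simp add: greatest_lorder_iff le_quotient_iff le_mod_of_le[OF N(1)])
qed (rule quotient_antisym; simp add: lorder_def)

text \<open>With the image under cosets this sets up the correspondence between convex subgroups of
  the quotient and those of \<open>G\<close> containing \<open>N\<close>; it preserves inclusion and
  properness, hence maximality in both directions.\<close>

definition coset_preimage :: "'a set set \<Rightarrow> 'a set" where
  "coset_preimage K = {x \<in> carrier G. N #> x \<in> K}"

lemma coset_mem_image_iff:
  assumes H: "convex_l_subgroup G H" "N \<subseteq> H" and x: "x \<in> carrier G"
  shows "N #> x \<in> (\<lambda>x. N #> x) ` H \<longleftrightarrow> x \<in> H"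
proof
  note D = convex_l_subgroupD[OF H(1)]
  assume "N #> x \<in> (\<lambda>x. N #> x) ` H"
  then obtain y where y: "y \<in> H" "N #> x = N #> y" by blast
  then have "x \<otimes> inv y \<in> H" using coset_eq_iff[OF x, of y] D(3) H(2) by blast
  then have "x \<otimes> inv y \<otimes> y \<in> H" using D(6) y by blast
  then show "x \<in> H" using x y D(3) by (simp add: m_assoc)
qed simp

lemma convex_image:
  assumes H: "convex_l_subgroup G H" "N \<subseteq> H"
  shows "convex_l_subgroup Q ((\<lambda>x. N #> x) ` H)"
proof -
  note D = convex_l_subgroupD[OF H(1)]
  let ?K = "(\<lambda>x. N #> x) ` H"
  have sg: "subgroup ?K Q"
  proof (rule group.subgroupI[OF group_quotient])
    show "?K \<subseteq> carrier Q" "?K \<noteq> {}" using D(3,4) by auto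
    show "inv\<^bsub>Q\<^esub> X \<in> ?K" if "X \<in> ?K" for X using that D(3,5) by (auto simp: inv_quotient)
    show "X \<otimes>\<^bsub>Q\<^esub> Y \<in> ?K" if "X \<in> ?K" "Y \<in> ?K" for X Y using that D(3,6) by (auto simp: mult_quotient)
  qed
  have lat: "X \<squnion>\<^bsub>lorder Q\<^esub> Y \<in> ?K \<and> X \<sqinter>\<^bsub>lorder Q\<^esub> Y \<in> ?K" if "X \<in> ?K" "Y \<in> ?K" for X Y
    using that D(3,7,8) by (auto simp: join_quotient meet_quotient)
  have conv: "Z \<in> ?K" if X: "X \<in> ?K" and Y: "Y \<in> ?K" and Z: "Z \<in> carrier Q" and le: "lle Q X Z" "lle Q Z Y" for X Y Z
  proof -
    obtain x y z where xyz: "x \<in> H" "y \<in> H" "z \<in> carrier G" "X = N #> x" "Y = N #> y" "Z = N #> z"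
      using X Y Z by (auto simp: carrier_quotient)
    have c: "x \<in> carrier G" "y \<in> carrier G" using xyz D(3) by auto
    then have "le_mod N x z" "le_mod N z y" using le xyz by (simp_all add: le_quotient_iff)
    then obtain h k where h: "h \<in> N" "x \<preceq> h \<otimes> z" and k: "k \<in> N" "z \<preceq> k \<otimes> y"
      by (auto simp: le_mod_def)
    have hH: "h \<in> H" "k \<in> H" "h \<in> carrier G" using h k H(2) D(3) by auto
    have "inv h \<otimes> x \<preceq> z" using h hH xyz c mult_le_cancel_left[of "inv h \<otimes> x" z h] by (simp add: m_assoc[symmetric])
    moreover have "inv h \<otimes> x \<in> H" "k \<otimes> y \<in> H" using D(5,6) hH xyz by auto
    ultimately have "z \<in> H" using D(9) k(2) xyz(3) by blast
    then show ?thesis using xyz by blast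
  qed
  show ?thesis unfolding convex_l_subgroup_def l_subgroup_def
  proof (intro conjI ballI impI sg)
    show "Z \<in> ?K" if "X \<in> ?K" "Y \<in> ?K" "Z \<in> carrier Q" "lle Q X Z" "lle Q Z Y" for X Y Z
      using that by (rule conv)
  qed (use lat in blast)+
qed

lemma convex_coset_preimage:
  assumes K: "convex_l_subgroup Q K"
  shows "convex_l_subgroup G (coset_preimage K)" "N \<subseteq> coset_preimage K"
    "K = (\<lambda>x. N #> x) ` coset_preimage K"
proof -
  have sg: "subgroup K Q" using K by (simp add: convex_l_subgroup_def l_subgroup_def)
  have lat: "X \<squnion>\<^bsub>lorder Q\<^esub> Y \<in> K \<and> X \<sqinter>\<^bsub>lorder Q\<^esub> Y \<in> K" if "X \<in> K" "Y \<in> K" for X Y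
    using K that unfolding convex_l_subgroup_def l_subgroup_def by blast
  have conv: "Z \<in> K" if "X \<in> K" "Y \<in> K" "Z \<in> carrier Q" "lle Q X Z" "lle Q Z Y" for X Y Z
    using K that unfolding convex_l_subgroup_def by blast
  have one: "N #> \<one> \<in> K" using subgroup.one_closed[OF sg] by (simp add: one_quotient)
  show "convex_l_subgroup G (coset_preimage K)"
  proof (rule convex_l_subgroupI)
    show "subgroup (coset_preimage K) G"
    proof (rule subgroupI)
      show "coset_preimage K \<noteq> {}" using one by (auto simp: coset_preimage_def)
      show "inv x \<in> coset_preimage K" if "x \<in> coset_preimage K" for x
        using that subgroup.m_inv_closed[OF sg, of "N #> x"] by (simp add: coset_preimage_def inv_quotient)
      show "x \<otimes> y \<in> coset_preimage K" if "x \<in> coset_preimage K" "y \<in> coset_preimage K" for x y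
        using that subgroup.m_closed[OF sg, of "N #> x" "N #> y"] by (simp add: coset_preimage_def mult_quotient)
    qed (auto simp: coset_preimage_def)
    show "x \<curlyvee> y \<in> coset_preimage K" "x \<curlywedge> y \<in> coset_preimage K"
      if "x \<in> coset_preimage K" "y \<in> coset_preimage K" for x y
      using that lat[of "N #> x" "N #> y"] by (simp_all add: coset_preimage_def join_quotient meet_quotient)
    show "z \<in> coset_preimage K"
      if "x \<in> coset_preimage K" "y \<in> coset_preimage K" "z \<in> carrier G" "x \<preceq> z" "z \<preceq> y" for x y z
      using that conv[of "N #> x" "N #> y" "N #> z"]
      by (simp add: coset_preimage_def le_quotient_iff le_mod_of_le[OF N(1)])
  qed
  show "N \<subseteq> coset_preimage K"
  proof
    fix x assume x: "x \<in> N"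
    then have "N #> x = N #> \<one>" using convex_l_subgroupD(3)[OF N(1)] by (simp add: coset_eq_iff)
    then show "x \<in> coset_preimage K" using x one convex_l_subgroupD(3)[OF N(1)] by (simp add: coset_preimage_def)
  qed
  show "K = (\<lambda>x. N #> x) ` coset_preimage K"
    using subgroup.subset[OF sg] by (auto simp: coset_preimage_def carrier_quotient)
qed

lemma coset_preimage_image:
  assumes H: "convex_l_subgroup G H" "N \<subseteq> H"
  shows "coset_preimage ((\<lambda>x. N #> x) ` H) = H"
proof -
  have "coset_preimage ((\<lambda>x. N #> x) ` H) = {x \<in> carrier G. x \<in> H}"
    unfolding coset_preimage_def by (rule Collect_cong) (simp add: coset_mem_image_iff[OF H] cong: conj_cong)
  then show ?thesis using convex_l_subgroupD(2)[OF H(1)] by blast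
qed

lemma coset_preimage_carrier: "coset_preimage (carrier Q) = carrier G"
  by (auto simp: coset_preimage_def)

lemma Max_quotient_image:
  assumes m: "m \<in> Max_l G" "N \<subseteq> m"
  shows "(\<lambda>x. N #> x) ` m \<in> Max_l Q"
proof -
  have c: "convex_l_subgroup G m" "m \<noteq> carrier G"
    and max: "\<And>H. convex_l_subgroup G H \<Longrightarrow> m \<subseteq> H \<Longrightarrow> H \<noteq> carrier G \<Longrightarrow> H = m"
    using m(1) by (auto simp: Max_l_def)
  let ?K = "(\<lambda>x. N #> x) ` m"
  have pre: "coset_preimage ?K = m" by (rule coset_preimage_image[OF c(1) m(2)])
  have "L = ?K" if L: "convex_l_subgroup Q L" "?K \<subseteq> L" "L \<noteq> carrier Q" for L
  proof -
    have "coset_preimage L \<noteq> carrier G"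
      using convex_coset_preimage(3)[OF L(1)] L(3) carrier_quotient by auto
    moreover have "m \<subseteq> coset_preimage L" using pre L(2) by (auto simp: coset_preimage_def)
    ultimately have "coset_preimage L = m" by (intro max convex_coset_preimage(1)[OF L(1)])
    then show ?thesis using convex_coset_preimage(3)[OF L(1)] by simp
  qed
  moreover have "?K \<noteq> carrier Q" using pre c(2) coset_preimage_carrier by metis
  ultimately show ?thesis using convex_image[OF c(1) m(2)] unfolding Max_l_def by blast
qed

lemma Max_quotient_preimage:
  assumes K: "K \<in> Max_l Q"
  shows "coset_preimage K \<in> Max_l G"
proof -
  have c: "convex_l_subgroup Q K" "K \<noteq> carrier Q"
    and max: "\<And>L. convex_l_subgroup Q L \<Longrightarrow> K \<subseteq> L \<Longrightarrow> L \<noteq> carrier Q \<Longrightarrow> L = K"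
    using K by (auto simp: Max_l_def)
  let ?m = "coset_preimage K"
  note pre = convex_coset_preimage[OF c(1)]
  have "H = ?m" if H: "convex_l_subgroup G H" "?m \<subseteq> H" "H \<noteq> carrier G" for H
  proof -
    have NH: "N \<subseteq> H" using pre(2) H(2) by blast
    let ?L = "(\<lambda>x. N #> x) ` H"
    have "?L \<noteq> carrier Q" using coset_preimage_image[OF H(1) NH] H(3) coset_preimage_carrier by metis
    moreover have "K \<subseteq> ?L" by (subst pre(3)) (rule image_mono[OF H(2)])
    ultimately have "?L = K" by (intro max convex_image[OF H(1) NH])
    then show ?thesis using coset_preimage_image[OF H(1) NH] by simp
  qed
  moreover have "?m \<noteq> carrier G" using pre(3) c(2) carrier_quotient by metis
  ultimately show ?thesis using pre(1) unfolding Max_l_def by blast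
qed

text \<open>By the correspondence, the coset of \<open>b\<close> lies in every maximal subgroup of
  the quotient exactly when \<open>b\<close> lies in every maximal subgroup of \<open>G\<close>
  above \<open>N\<close>. For \<open>N = G(a)\<close> this is the instance of
  \<open>yosida_iff\<close> at \<open>a\<close>.\<close>

lemma enough_maximal_quotient_iff:
  "enough_maximal Q \<longleftrightarrow> (\<forall>b\<in>carrier G. (\<forall>m\<in>Max_l G. N \<subseteq> m \<longrightarrow> b \<in> m) \<longrightarrow> b \<in> N)"
proof -
  have coset_one: "N #> b = N #> \<one> \<longleftrightarrow> b \<in> N" if "b \<in> carrier G" for b
    using that by (simp add: coset_eq_iff)
  have mem: "N #> b \<in> Inter_l Q (Max_l Q) \<longleftrightarrow> (\<forall>m\<in>Max_l G. N \<subseteq> m \<longrightarrow> b \<in> m)"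
    if b: "b \<in> carrier G" for b
  proof
    assume L: "N #> b \<in> Inter_l Q (Max_l Q)"
    show "\<forall>m\<in>Max_l G. N \<subseteq> m \<longrightarrow> b \<in> m"
    proof (intro ballI impI)
      fix m assume m: "m \<in> Max_l G" "N \<subseteq> m"
      have "N #> b \<in> (\<lambda>x. N #> x) ` m" using L Max_quotient_image[OF m] by (simp add: Inter_l_def)
      then show "b \<in> m" using coset_mem_image_iff[OF _ m(2) b] m(1) by (simp add: Max_l_def)
    qed
  next
    assume R: "\<forall>m\<in>Max_l G. N \<subseteq> m \<longrightarrow> b \<in> m"
    have "N #> b \<in> K" if K: "K \<in> Max_l Q" for K
    proof -
      have "N \<subseteq> coset_preimage K" using K by (intro convex_coset_preimage) (simp add: Max_l_def)
      then have "b \<in> coset_preimage K" using R Max_quotient_preimage[OF K] by blast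
      then show ?thesis by (simp add: coset_preimage_def)
    qed
    then show "N #> b \<in> Inter_l Q (Max_l Q)" using b by (simp add: Inter_l_def)
  qed
  have "N #> \<one> \<in> Inter_l Q (Max_l Q)"
    unfolding mem[OF one_closed] using convex_l_subgroupD(4) by (auto simp: Max_l_def)
  then have "enough_maximal Q \<longleftrightarrow> (\<forall>X\<in>carrier Q. X \<in> Inter_l Q (Max_l Q) \<longrightarrow> X = N #> \<one>)"
    unfolding enough_maximal_def one_quotient by (auto simp: Inter_l_def)
  also have "\<dots> \<longleftrightarrow> (\<forall>b\<in>carrier G. N #> b \<in> Inter_l Q (Max_l Q) \<longrightarrow> N #> b = N #> \<one>)"
    by (simp add: carrier_quotient)
  also have "\<dots> \<longleftrightarrow> (\<forall>b\<in>carrier G. (\<forall>m\<in>Max_l G. N \<subseteq> m \<longrightarrow> b \<in> m) \<longrightarrow> b \<in> N)"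
    by (simp add: mem coset_one)
  finally show ?thesis .
qed

end

lemma yosida_iff_quotients:
  "yosida G \<longleftrightarrow> (\<forall>a\<in>carrier G. enough_maximal (l_quotient G (principal_l G a)))"
proof -
  have "enough_maximal (l_quotient G (principal_l G a)) \<longleftrightarrow>
      (\<forall>b\<in>carrier G. (\<forall>m\<in>Max_l G. a \<in> m \<longrightarrow> b \<in> m) \<longrightarrow> b \<in> principal_l G a)"
    if a: "a \<in> carrier G" for a
  proof -
    have "principal_l G a \<subseteq> m \<longleftrightarrow> a \<in> m" if "m \<in> Max_l G" for m
      using that principal_subset_iff[OF _ a, of m] by (simp add: Max_l_def)
    then show ?thesis
      using enough_maximal_quotient_iff[OF convex_principal[OF a] normal_principal[OF a]] by simp
  qed
  then show ?thesis unfolding yosida_iff by simp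
qed

end

theorem theorem5p2:
  fixes G :: "('a, 'b) lgroup_scheme"
  assumes "lgroup G"
    and "\<And>a. a \<in> carrier G \<Longrightarrow> principal_l G a \<lhd> G"
  shows "(ideally_conjunctive (principal_lattice G) \<longleftrightarrow> yosida G) \<and>
    (yosida G \<longleftrightarrow>
      (\<exists>(X :: 'a set set) \<phi>. l_embedding G (real_power X) \<phi> \<and>
        (\<forall>a\<in>carrier G. principal_l G a = zero_hull G (zeros_map X \<phi>) a))) \<and>
    (yosida G \<longleftrightarrow>
      (\<exists>M \<subseteq> Max_l G. Inter_l G M = {\<one>\<^bsub>G\<^esub>} \<and>
        (\<forall>a\<in>carrier G. principal_l G a = zero_hull G (zeros_max M) a))) \<and>
    (yosida G \<longleftrightarrow>
      (\<exists>M \<subseteq> Max_l G. Inter_l G M = {\<one>\<^bsub>G\<^esub>} \<and>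
        patch_topology G closure_of M = Spec_l G)) \<and>
    (yosida G \<longleftrightarrow> (\<forall>H. l_subgroup G H \<longrightarrow> yosida (G\<lparr>carrier := H\<rparr>))) \<and>
    (yosida G \<longleftrightarrow> (\<forall>a\<in>carrier G. enough_maximal (l_quotient G (principal_l G a))))"
proof -
  interpret hamiltonian_lgroup G
    using assms by (simp add: hamiltonian_lgroup_def hamiltonian_lgroup_axioms_def)
  \<comment> \<open>The representation built from the Yosida property is indexed by
    \<open>Max_l G\<close>, which already has the type demanded of \<open>X\<close>.\<close>
  have "yosida G \<longleftrightarrow> (\<exists>(X :: 'a set set) \<phi>. zero_representation G X \<phi>)"
    using zero_representation_imp_yosida yosida_imp_zero_representation by metis
  then show ?thesis
    unfolding zero_representation_def
    by (intro conjI ideally_conjunctive_iff_yosida yosida_iff_zeros_max yosida_iff_patch_dense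
        yosida_iff_l_subgroups yosida_iff_quotients)
qed

end
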